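(* Let $E_1, E_2, \ldots$ be i.i.d.\ exponential random variables with mean $1$, $Z_k = E_1 + \cdots + E_k$, and $\Psi(x) = 2^{\{\log_2 x\}}$ for $x > 0$. Let $\gamma > 0$ and for integers $r \geq 0$ let \[ Y_{r,\gamma} = \sum_{k=r+1}^\infty \left( \frac{\Psi(Z_k/\gamma)}{Z_k} - \frac{\Psi(k/\gamma)}{k}\right), \qquad A_{r,\gamma} = \sum_{k=1}^r \frac{\Psi(k/\gamma)}{k} \] (so $A_{0,\gamma} = 0$). Then for any $r = 0,1,2,\ldots$, as $x \to \infty$, \[ \mathbb{P}\{Y_{r,\gamma} > x\} \sim \frac{2^{\{\log_2(\gamma x)\}(r+1)}}{(r+1)!\, x^{r+1}}\left[ 2^{-r-1} + (2^{r+1}-1) \sum_{\ell=0}^1 2^{-\ell(r+1)} \mathbb{P}\left\{ Y_{0,\gamma} + A_{r,\gamma} > x\left(1 - 2^{\ell - \{\log_2(\gamma x)\}}\right)\right\}\right]. \]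
   Context: $\{y\}$ denotes the fractional part of $y$. The series defining $Y_{r,\gamma}$ converges absolutely almost surely. $f(x) \sim g(x)$ means $f(x)/g(x) \to 1$. *)

theory Defs
  imports "HOL-Probability.Probability" "HOL-Library.Landau_Symbols"
begin

definition Psi :: "real \<Rightarrow> real" where
  "Psi x = 2 powr frac (log 2 x)"

definition Zsum :: "(nat \<Rightarrow> 'a \<Rightarrow> real) \<Rightarrow> nat \<Rightarrow> 'a \<Rightarrow> real" where
  "Zsum E k \<omega> = (\<Sum>i=1..k. E i \<omega>)"

definition Yrg :: "(nat \<Rightarrow> 'a \<Rightarrow> real) \<Rightarrow> nat \<Rightarrow> real \<Rightarrow> 'a \<Rightarrow> real" where
  "Yrg E r \<gamma> \<omega> = (\<Sum>j. let k = j + r + 1 in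
      Psi (Zsum E k \<omega> / \<gamma>) / Zsum E k \<omega> - Psi (real k / \<gamma>) / real k)"

definition Arg_sum :: "nat \<Rightarrow> real \<Rightarrow> real" where
  "Arg_sum r \<gamma> = (\<Sum>k=1..r. Psi (real k / \<gamma>) / real k)"

end

theory Submission
  imports Defs "HOL-Real_Asymp.Real_Asymp"
begin

text \<open>
  Write \<open>g z = \<Psi>(z/\<gamma>)/z\<close>. This is a nonincreasing step function, equal to \<open>2\<^sup>-\<^sup>m/\<gamma>\<close> on
  \<open>[\<gamma>2\<^sup>m, \<gamma>2\<^sup>m\<^sup>+\<^sup>1)\<close>. With \<open>T = Z\<^bsub>r+1\<^esub>\<close> and the independent sequence of the later
  exponential variables, a telescoping sum gives \<open>Y\<^sub>r = g(T) + A\<^sub>r + V(T)\<close>, where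
  \<open>V(t) = \<Sum>\<^sub>j (g(t + Z'\<^sub>j) - g(j))\<close> is nonincreasing in \<open>t\<close> and \<open>V(0)\<close> has the law of \<open>Y\<^sub>0\<close>.

  Apart from an event of probability \<open>O(x\<^bsup>-r-2\<^esup>)\<close>, \<open>Y\<^sub>r > x\<close> forces \<open>g(T) > x/2\<close>. Put
  \<open>a = 2\<^bsup>{log(\<gamma>x)}\<^esup>/x\<close> (log to base 2). Then \<open>T < 2a\<close>, and \<open>g(T)\<close> is \<open>1/a\<close> on \<open>[a, 2a)\<close>,
  \<open>2/a\<close> on \<open>[a/2, a)\<close> and at least \<open>4/a > 2x\<close> below; these cells produce the three terms of
  the formula. Since \<open>V(2a) \<le> V(T) \<le> V(0)\<close> there, it remains to replace \<open>V(2a)\<close> by \<open>V(0)\<close>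
  uniformly in the threshold, for which the law of \<open>V(0)\<close> must have no atoms: \<open>V\<close> is almost surely
  strictly decreasing, because the renewal process \<open>Z'\<close> hits \<open>[\<gamma>2\<^sup>m - t, \<gamma>2\<^sup>m - s)\<close> for some \<open>m\<close>,
  and \<open>Y\<^sub>0 = g(E\<^sub>1) + V(E\<^sub>1)\<close> with \<open>E\<^sub>1\<close> independent of \<open>V\<close>.
\<close>

subsection \<open>The step function and its oscillation\<close>

definition step_fun :: "real \<Rightarrow> real \<Rightarrow> real" where
  "step_fun \<gamma> z = Psi (z / \<gamma>) / z"

text \<open>Because \<open>frac y\<close> is \<open>y\<close> minus its integer part, the factor
  \<open>z\<close> cancels and only the integer part of \<open>log 2 (z / \<gamma>)\<close>
  survives; monotonicity and the step structure are read off from this form.\<close>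

lemma step_fun_eq:
  assumes "\<gamma> > 0" "z > 0"
  shows "step_fun \<gamma> z = 2 powr (- of_int \<lfloor>log 2 (z / \<gamma>)\<rfloor>) / \<gamma>"
proof -
  have "Psi (z / \<gamma>) = 2 powr (log 2 (z / \<gamma>)) * 2 powr (- of_int \<lfloor>log 2 (z / \<gamma>)\<rfloor>)"
    unfolding Psi_def frac_def powr_add [symmetric] by simp
  also have "2 powr (log 2 (z / \<gamma>)) = z / \<gamma>" using assms by simp
  finally show ?thesis using assms by (simp add: step_fun_def field_simps)
qed

lemma step_fun_antimono:
  assumes "\<gamma> > 0" "0 < z" "z \<le> z'"
  shows "step_fun \<gamma> z' \<le> step_fun \<gamma> z"
proof -
  have "\<lfloor>log 2 (z / \<gamma>)\<rfloor> \<le> \<lfloor>log 2 (z' / \<gamma>)\<rfloor>"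
    using assms by (intro floor_mono) (simp add: divide_right_mono)
  then show ?thesis using assms by (simp add: step_fun_eq divide_right_mono)
qed

lemma step_fun_nonneg: "z \<ge> 0 \<Longrightarrow> 0 \<le> step_fun \<gamma> z"
  by (simp add: step_fun_def Psi_def)

lemma step_fun_le: "z > 0 \<Longrightarrow> step_fun \<gamma> z \<le> 2 / z"
proof -
  assume z: "z > 0"
  have "2 powr frac (log 2 (z / \<gamma>)) \<le> 2 powr (1::real)"
    by (intro powr_mono) (auto intro: less_imp_le frac_lt_1)
  then show ?thesis using z by (simp add: step_fun_def Psi_def divide_right_mono)
qed

lemma step_fun_dyadic:
  assumes "\<gamma> > 0" "\<gamma> * 2 powr of_int m \<le> z" "z < \<gamma> * 2 powr of_int (m + 1)"
  shows "step_fun \<gamma> z = 2 powr (- of_int m) / \<gamma>"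
proof -
  have z: "z > 0" using assms(1,2) by (smt (verit) mult_pos_pos powr_gt_zero)
  have "\<lfloor>log 2 (z / \<gamma>)\<rfloor> = m"
  proof (rule floor_unique)
    show "of_int m \<le> log 2 (z / \<gamma>)" using assms z by (simp add: le_log_iff field_simps)
    show "log 2 (z / \<gamma>) < of_int m + 1" using assms z by (simp add: log_less_iff field_simps)
  qed
  then show ?thesis using assms(1) z by (simp add: step_fun_eq)
qed

text \<open>A jump point between \<open>z\<close> and \<open>z'\<close> separates the integer parts.
  This is the source of strictness for \<open>Vf\<close>.\<close>

lemma step_fun_strict:
  assumes "\<gamma> > 0" "0 < z" "z < \<gamma> * 2 powr of_int m" "\<gamma> * 2 powr of_int m \<le> z'"
  shows "step_fun \<gamma> z' < step_fun \<gamma> z"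
proof -
  have z': "z' > 0" using assms by linarith
  have "\<lfloor>log 2 (z / \<gamma>)\<rfloor> < m"
    using assms by (simp add: floor_less_iff log_less_iff field_simps)
  moreover have "m \<le> \<lfloor>log 2 (z' / \<gamma>)\<rfloor>"
    using assms z' by (simp add: le_floor_iff le_log_iff field_simps)
  ultimately show ?thesis using assms z'
    by (simp add: step_fun_eq divide_strict_right_mono)
qed

text \<open>The cells are closed on the left, so \<open>step_fun \<gamma>\<close> is constant on a
  right neighbourhood of \<open>z\<close>.\<close>

lemma step_fun_right_continuous:
  assumes "\<gamma> > 0" "z > 0"
  shows "((\<lambda>t. step_fun \<gamma> (t + z)) \<longlongrightarrow> step_fun \<gamma> z) (at_right 0)"
proof -
  define m where "m = \<lfloor>log 2 (z / \<gamma>)\<rfloor>"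
  have le: "\<gamma> * 2 powr of_int m \<le> z"
  proof -
    have "of_int m \<le> log 2 (z / \<gamma>)" by (simp add: m_def)
    then have "2 powr of_int m \<le> z / \<gamma>" using assms by (subst (asm) le_log_iff) auto
    then show ?thesis using assms by (simp add: field_simps)
  qed
  have "log 2 (z / \<gamma>) < of_int m + 1"
    by (simp add: m_def)
  then have less: "z < \<gamma> * 2 powr of_int (m + 1)"
    using assms by (simp add: log_less_iff field_simps)
  have "eventually (\<lambda>t. t \<in> {0<..<\<gamma> * 2 powr of_int (m + 1) - z}) (at_right 0)"
    using less by (intro eventually_at_rightI[of 0 "\<gamma> * 2 powr of_int (m + 1) - z"]) auto
  then have "eventually (\<lambda>t. step_fun \<gamma> z = step_fun \<gamma> (t + z)) (at_right 0)"
  proof eventually_elim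
    case (elim t)
    then show ?case using step_fun_dyadic[OF assms(1) le less] step_fun_dyadic[OF assms(1), of m "t + z"] le by auto
  qed
  then show ?thesis by (rule Lim_transform_eventually[OF tendsto_const])
qed

lemma step_fun_measurable[measurable]: "step_fun \<gamma> \<in> borel_measurable borel"
proof -
  have "step_fun \<gamma> = (\<lambda>z. 2 powr (log 2 (z / \<gamma>) - real_of_int \<lfloor>log 2 (z / \<gamma>)\<rfloor>) / z)"
    by (simp add: fun_eq_iff step_fun_def Psi_def frac_def)
  also have "\<dots> \<in> borel_measurable borel" by measurable
  finally show ?thesis .
qed

section \<open>Summability of the oscillations along the integers\<close>

text \<open>With nonnegative terms it suffices to bound the partial sums, and \<open>{..n}\<close>
  lies in \<open>{0}\<close> together with the first \<open>Suc n\<close> dyadic blocks.\<close>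

lemma summable_dyadic_blocks:
  fixes f :: "nat \<Rightarrow> real"
  assumes nn: "\<And>k. 0 \<le> f k" and sm: "summable (\<lambda>j. \<Sum>k\<in>{2^j..<2^Suc j}. f k)"
  shows "summable f"
proof (rule bounded_imp_summable[OF nn])
  fix n :: nat
  have eq: "(\<Sum>k\<in>{1..<2^n}. f k) = (\<Sum>j<n. \<Sum>k\<in>{2^j..<2^Suc j}. f k)" for n
  proof (induction n)
    case (Suc n)
    have "(\<Sum>k\<in>{1..<2^Suc n}. f k) = (\<Sum>k\<in>{1..<2^n}. f k) + (\<Sum>k\<in>{2^n..<2^Suc n}. f k)"
      by (subst sum.atLeastLessThan_concat) auto
    then show ?case using Suc by simp
  qed auto
  have "(\<Sum>k\<le>n. f k) \<le> (\<Sum>k\<in>insert 0 {1..<2^Suc n}. f k)"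
  proof (intro sum_mono2)
    show "{..n} \<subseteq> insert 0 {1..<2 ^ Suc n}"
      using less_exp[of "Suc n"] by auto
  qed (auto intro: nn)
  also have "\<dots> = f 0 + (\<Sum>j<Suc n. \<Sum>k\<in>{2^j..<2^Suc j}. f k)"
    unfolding eq[symmetric] by (subst sum.insert) auto
  also have "\<dots> \<le> f 0 + (\<Sum>j. \<Sum>k\<in>{2^j..<2^Suc j}. f k)"
    by (intro add_left_mono sum_le_suminf[OF sm]) (auto intro: sum_nonneg nn)
  finally show "(\<Sum>k\<le>n. f k) \<le> f 0 + (\<Sum>j. \<Sum>k\<in>{2^j..<2^Suc j}. f k)" .
qed

text \<open>Extending the left-shifted window to the end of the right-shifted one only adds
  nonnegative terms; then the two differ in the \<open>2 * d\<close> leftmost terms, each at most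
  \<open>H (a - d)\<close>.\<close>

lemma sum_shift_diff_le:
  fixes H :: "nat \<Rightarrow> real"
  assumes nn: "\<And>k. 0 \<le> H k" and anti: "\<And>k l. a - d \<le> k \<Longrightarrow> k \<le> l \<Longrightarrow> H l \<le> H k" and d: "d \<le> a" "a \<le> b"
  shows "(\<Sum>k\<in>{a..<b}. H (k - d) - H (k + d)) \<le> 2 * real d * H (a - d)"
proof -
  have 1: "(\<Sum>k\<in>{a..<b}. H (k - d)) = (\<Sum>k\<in>{a-d..<b-d}. H k)"
    using d by (intro sum.reindex_bij_witness[of _ "\<lambda>k. k + d" "\<lambda>k. k - d"]) auto
  have 2: "(\<Sum>k\<in>{a..<b}. H (k + d)) = (\<Sum>k\<in>{a+d..<b+d}. H k)"
    by (rule sum.shift_bounds_nat_ivl [symmetric])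
  have "(\<Sum>k\<in>{a-d..<b-d}. H k) \<le> (\<Sum>k\<in>{a-d..<b+d}. H k)"
    by (intro sum_mono2) (auto intro: nn)
  also have "\<dots> = (\<Sum>k\<in>{a-d..<a+d}. H k) + (\<Sum>k\<in>{a+d..<b+d}. H k)"
    using d by (subst sum.atLeastLessThan_concat) auto
  also have "(\<Sum>k\<in>{a-d..<a+d}. H k) \<le> real (card {a-d..<a+d}) * H (a - d)"
    by (rule sum_bounded_above) (auto intro: anti)
  also have "card {a-d..<a+d} = 2 * d" using d by simp
  finally show ?thesis unfolding sum_subtractf 1 2 by simp
qed

text \<open>
  The exponent \<open>7/8\<close> is below 1, but large enough that the fourth moment bound for
  \<open>|Z\<^sub>k - k| > k\<^bsup>7/8\<^esup>\<close> is summable; the factor 2 leaves room for a bounded shift.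
\<close>

definition dev :: "nat \<Rightarrow> real" where
  "dev k = 2 * real k powr (7/8)"

text \<open>The variation of \<open>step_fun\<close> over the window of radius \<open>dev k\<close>
  around \<open>k\<close>. The default 0 covers the finitely many \<open>k\<close> (see
  \<open>eventually_dev\<close>) whose window is too wide to stay safely on the positive
  axis.\<close>

definition osc :: "real \<Rightarrow> nat \<Rightarrow> real" where
  "osc \<gamma> k = (if dev k \<le> real k / 2 \<and> k > 0 then step_fun \<gamma> (real k - dev k) - step_fun \<gamma> (real k + dev k) else 0)"

lemma dev_nonneg: "0 \<le> dev k" by (simp add: dev_def)

lemma osc_nonneg: "\<gamma> > 0 \<Longrightarrow> 0 \<le> osc \<gamma> k"
  using dev_nonneg[of k] by (auto simp: osc_def intro!: step_fun_antimono)

lemma osc_bound: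
  assumes "\<gamma> > 0" "k > 0" "dev k \<le> real k / 2" "\<bar>z - real k\<bar> \<le> dev k"
  shows "\<bar>step_fun \<gamma> z - step_fun \<gamma> (real k)\<bar> \<le> osc \<gamma> k"
proof -
  have "0 < real k - dev k" using assms by simp
  then have "step_fun \<gamma> z \<le> step_fun \<gamma> (real k - dev k)" "step_fun \<gamma> (real k) \<le> step_fun \<gamma> (real k - dev k)"
    "step_fun \<gamma> (real k + dev k) \<le> step_fun \<gamma> z" "step_fun \<gamma> (real k + dev k) \<le> step_fun \<gamma> (real k)"
    using assms dev_nonneg[of k] by (auto intro!: step_fun_antimono)
  then show ?thesis using assms by (simp add: osc_def)
qed

lemma eventually_dev: "eventually (\<lambda>k. dev k \<le> real k / 2) sequentially"
proof -
  have "((\<lambda>k::nat. real k powr (-1/8)) \<longlongrightarrow> 0) sequentially"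
    by (rule tendsto_neg_powr) (auto intro: filterlim_real_sequentially)
  then have "eventually (\<lambda>k::nat. real k powr (-1/8) < 1/4) sequentially"
    by (rule order_tendstoD) auto
  then show ?thesis using eventually_gt_at_top[of 0]
  proof eventually_elim
    case (elim k)
    have "real k powr (7/8) = real k powr 1 * real k powr (-1/8)"
      unfolding powr_add[symmetric] by simp
    also have "\<dots> \<le> real k powr 1 * (1/4)" using elim by (intro mult_left_mono) auto
    finally show ?case using elim by (simp add: dev_def)
  qed
qed

text \<open>
  On the block \<open>[2\<^sup>j, 2\<^sup>j\<^sup>+\<^sup>1)\<close> the differences telescope up to \<open>2d\<close> terms with \<open>d\<close> of order
  \<open>2\<^bsup>7j/8\<^esup>\<close>, each of order \<open>2\<^sup>-\<^sup>j\<close>, so that the block sums decay geometrically.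
\<close>

lemma summable_osc:
  assumes g: "\<gamma> > 0"
  shows "summable (osc \<gamma>)"
proof (rule summable_dyadic_blocks[OF osc_nonneg[OF g]])
  \<comment> \<open>A single integer shift dominating \<open>dev k\<close> for all \<open>k\<close>
    in the block, taken from the right end of the block.\<close>
  define d where "d j = nat \<lceil>dev (2 ^ Suc j)\<rceil>" for j
  have d_ge: "dev (2 ^ Suc j) \<le> real (d j)" for j
    unfolding d_def by (simp add: dev_nonneg)
  have d_le: "real (d j) \<le> dev (2 ^ Suc j) + 1" for j
    unfolding d_def using dev_nonneg[of "2 ^ Suc j"] by linarith
  have dev_eq: "dev (2 ^ Suc j) = 2 * 2 powr (7/8) * 2 powr (7/8 * real j)" for j
  proof -
    have "dev (2 ^ Suc j) = 2 * (2 powr (real (Suc j))) powr (7/8)"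
      by (simp add: dev_def powr_realpow del: of_nat_Suc)
    also have "\<dots> = 2 * 2 powr (7/8 + 7/8 * real j)" by (simp add: powr_powr add_divide_distrib algebra_simps)
    finally show ?thesis by (simp add: powr_add)
  qed
  have pj: "2 ^ j = 2 powr (real j)" for j by (simp add: powr_realpow)
  have rat: "2 powr (7/8 * real j) / 2 ^ j = (2 powr (-1/8)) ^ j" for j
  proof -
    have "2 powr (7/8 * real j) / 2 ^ j = 2 powr (7/8 * real j - real j)" unfolding pj powr_diff ..
    also have "7/8 * real j - real j = (-1/8) * real j" by simp
    also have "2 powr ((-1/8) * real j) = (2 powr (-1/8)) ^ j"
      by (subst powr_powr[symmetric]) (simp add: powr_realpow)
    finally show ?thesis .
  qed
  have geo: "summable (\<lambda>j. (8 * (2 * 2 powr (7/8) + 1) :: real) * (2 powr (-1/8)) ^ j)"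
  proof -
    have "(2::real) powr (-1/8) < 2 powr 0" by (rule powr_less_mono) auto
    then show ?thesis by (intro summable_mult summable_geometric) auto
  qed
  have dr: "real (d j) / 2 ^ j \<le> (2 * 2 powr (7/8) + 1) * (2 powr (-1/8)) ^ j" for j
  proof -
    have "1 \<le> (2::real) powr (7/8 * real j)" by (rule ge_one_powr_ge_zero) auto
    then have "real (d j) \<le> (2 * 2 powr (7/8) + 1) * 2 powr (7/8 * real j)"
      using d_le[of j] unfolding dev_eq by (simp add: algebra_simps)
    then have "real (d j) / 2 ^ j \<le> (2 * 2 powr (7/8) + 1) * 2 powr (7/8 * real j) / 2 ^ j"
      by (rule divide_right_mono) simp
    then show ?thesis by (simp only: rat[symmetric] times_divide_eq_right)
  qed
  \<comment> \<open>A value below 4 means \<open>d j / 2 ^ j <= 1 / 2\<close>, so the shifted blocks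
    do not reach below \<open>2 ^ j / 2\<close>.\<close>
  have "eventually (\<lambda>j. (8 * (2 * 2 powr (7/8) + 1) :: real) * (2 powr (-1/8)) ^ j < 4) sequentially"
    using summable_LIMSEQ_zero[OF geo] by (rule order_tendstoD) auto
  then have "eventually (\<lambda>j. norm (\<Sum>k\<in>{2^j..<2^Suc j}. osc \<gamma> k) \<le> (8 * (2 * 2 powr (7/8) + 1)) * (2 powr (-1/8)) ^ j) sequentially"
  proof eventually_elim
    case (elim j)
    have "real (d j) / 2 ^ j \<le> 1 / 2" using dr[of j] elim by linarith
    then have d2: "2 * real (d j) \<le> 2 ^ j" by (simp add: field_simps)
    then have d2': "2 * d j \<le> 2 ^ j" by (metis of_nat_le_iff of_nat_mult of_nat_numeral of_nat_power)
    have "0 < (2::nat) ^ j" by simp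
    with d2' have d3: "d j < 2 ^ j" by linarith
    have "(\<Sum>k\<in>{2^j..<2^Suc j}. osc \<gamma> k)
       \<le> (\<Sum>k\<in>{2^j..<2^Suc j}. step_fun \<gamma> (real (k - d j)) - step_fun \<gamma> (real (k + d j)))"
    proof (intro sum_mono)
      fix k :: nat assume k: "k \<in> {2^j..<2^Suc j}"
      have kd: "d j < k" using d3 k by simp
      have "real k \<le> real (2 ^ Suc j)" using k unfolding of_nat_le_iff by simp
      then have "real k powr (7/8) \<le> real (2 ^ Suc j) powr (7/8)"
        by (intro powr_mono2) simp_all
      then have dk: "dev k \<le> real (d j)" using d_ge[of j] by (simp add: dev_def)
      show "osc \<gamma> k \<le> step_fun \<gamma> (real (k - d j)) - step_fun \<gamma> (real (k + d j))"
      proof (cases "dev k \<le> real k / 2 \<and> k > 0")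
        case True
        have "step_fun \<gamma> (real k - dev k) \<le> step_fun \<gamma> (real (k - d j))"
          using g kd dk by (intro step_fun_antimono) auto
        moreover have "step_fun \<gamma> (real (k + d j)) \<le> step_fun \<gamma> (real k + dev k)"
          using g kd dk dev_nonneg[of k] by (intro step_fun_antimono) auto
        ultimately show ?thesis using True by (simp add: osc_def)
      next
        case False
        have "step_fun \<gamma> (real (k + d j)) \<le> step_fun \<gamma> (real (k - d j))"
          using g kd by (intro step_fun_antimono) auto
        then show ?thesis using False unfolding osc_def by auto
      qed
    qed
    also have "\<dots> \<le> 2 * real (d j) * step_fun \<gamma> (real (2 ^ j - d j))"
    proof (rule sum_shift_diff_le[where H = "\<lambda>k. step_fun \<gamma> (real k)"])
      show "0 \<le> step_fun \<gamma> (real k)" for k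
        by (simp add: step_fun_nonneg)
    qed (use g d3 in \<open>auto intro!: step_fun_antimono\<close>)
    also have "\<dots> \<le> 2 * real (d j) * (2 / real (2 ^ j - d j))"
      using d3 by (intro mult_left_mono step_fun_le) auto
    also have "\<dots> \<le> 2 * real (d j) * (2 / (2 ^ j / 2))"
      using d2 d3 by (intro mult_left_mono divide_left_mono) (auto simp: of_nat_diff)
    also have "\<dots> = 8 * (real (d j) / 2 ^ j)" by simp
    also have "\<dots> \<le> 8 * ((2 * 2 powr (7/8) + 1) * (2 powr (-1/8)) ^ j)"
      using dr[of j] by (intro mult_left_mono) auto
    finally have "(\<Sum>k\<in>{2^j..<2^Suc j}. osc \<gamma> k) \<le> (8 * (2 * 2 powr (7/8) + 1)) * (2 powr (-1/8)) ^ j"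
      by (simp only: mult.assoc)
    moreover have "0 \<le> (\<Sum>k\<in>{2^j..<2^Suc j}. osc \<gamma> k)"
      by (intro sum_nonneg osc_nonneg g)
    ultimately show ?case by (simp only: real_norm_def abs_of_nonneg)
  qed
  then show "summable (\<lambda>j. \<Sum>k\<in>{2^j..<2^Suc j}. osc \<gamma> k)"
    by (rule summable_comparison_test_ev[OF _ geo])
qed

lemma step_fun_seq_tendsto_0: "(\<lambda>k. step_fun \<gamma> (real k)) \<longlonglongrightarrow> 0"
proof (rule tendsto_sandwich[of "\<lambda>_. 0" _ _ "\<lambda>k. 2 / real k"])
  show "eventually (\<lambda>k. step_fun \<gamma> (real k) \<le> 2 / real k) sequentially"
    using eventually_gt_at_top[of 0] by eventually_elim (auto intro: step_fun_le)
  show "eventually (\<lambda>k. 0 \<le> step_fun \<gamma> (real k)) sequentially"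
    using eventually_gt_at_top[of 0] by eventually_elim (auto intro: step_fun_nonneg)
  show "(\<lambda>k. 2 / real k) \<longlonglongrightarrow> 0"
    by (intro tendsto_divide_0[OF tendsto_const] filterlim_at_top_imp_at_infinity filterlim_real_sequentially)
qed auto

subsection \<open>The decomposition of the trimmed sum\<close>

text \<open>Coordinates are counted from 0: \<open>w i\<close> stands for the variable numbered
  \<open>i + 1\<close>, so \<open>Zs w k\<close> is \<open>Z_k\<close>.\<close>

definition Zs :: "(nat \<Rightarrow> real) \<Rightarrow> nat \<Rightarrow> real" where
  "Zs w k = (\<Sum>i<k. w i)"

definition Vf :: "real \<Rightarrow> real \<Rightarrow> (nat \<Rightarrow> real) \<Rightarrow> real" where
  "Vf \<gamma> t w = (\<Sum>j. step_fun \<gamma> (t + Zs w (Suc j)) - step_fun \<gamma> (real (Suc j)))"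

definition Yf :: "real \<Rightarrow> nat \<Rightarrow> (nat \<Rightarrow> real) \<Rightarrow> real" where
  "Yf \<gamma> r w = (\<Sum>j. step_fun \<gamma> (Zs w (j + r + 1)) - step_fun \<gamma> (real (j + r + 1)))"

text \<open>The deterministic properties behind the pathwise arguments; they hold almost surely, see
  \<open>AE_regular_path\<close>.\<close>

definition regular_path :: "(nat \<Rightarrow> real) \<Rightarrow> bool" where
  "regular_path w \<longleftrightarrow> (\<forall>i. 0 < w i) \<and> eventually (\<lambda>k. \<bar>Zs w k - real k\<bar> \<le> real k powr (7/8)) sequentially"

lemma Zs_pos: "(\<And>i. 0 < w i) \<Longrightarrow> 0 < k \<Longrightarrow> 0 < Zs w k"
  unfolding Zs_def by (intro sum_pos) auto

lemma Zs_mono: "(\<And>i. 0 < w i) \<Longrightarrow> k \<le> l \<Longrightarrow> Zs w k \<le> Zs w l"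
  unfolding Zs_def by (intro sum_mono2) (auto intro: less_imp_le)

lemma Yf_0: "Yf \<gamma> 0 w = Vf \<gamma> 0 w"
  by (simp add: Yf_def Vf_def)

text \<open>Eventually \<open>B\<close> is below \<open>real k powr (7/8)\<close>, so shift and
  deviation together stay within \<open>dev k\<close>. The threshold on \<open>k\<close> serves all
  \<open>t\<close> at once, as the limit in \<open>Vf_right_continuous\<close> requires.\<close>

lemma eventually_osc_bound:
  assumes g: "\<gamma> > 0" and w: "regular_path w"
  shows "eventually (\<lambda>k. \<forall>t\<in>{0..B}. \<bar>step_fun \<gamma> (t + Zs w k) - step_fun \<gamma> (real k)\<bar> \<le> osc \<gamma> k) sequentially"
proof -
  have "filterlim (\<lambda>k::nat. real k powr (7/8)) at_top sequentially"
    by real_asymp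
  then have "eventually (\<lambda>k::nat. B \<le> real k powr (7/8)) sequentially"
    by (simp add: filterlim_at_top)
  moreover have "eventually (\<lambda>k. \<bar>Zs w k - real k\<bar> \<le> real k powr (7/8)) sequentially"
    using w by (simp add: regular_path_def)
  ultimately show ?thesis using eventually_dev eventually_gt_at_top[of 0]
  proof eventually_elim
    case (elim k)
    show ?case
    proof
      fix t assume "t \<in> {0..B}"
      then have "\<bar>(t + Zs w k) - real k\<bar> \<le> dev k" using elim by (auto simp: dev_def)
      then show "\<bar>step_fun \<gamma> (t + Zs w k) - step_fun \<gamma> (real k)\<bar> \<le> osc \<gamma> k"
        using elim g by (intro osc_bound) auto
    qed
  qed
qed

lemma summable_Vf:
  assumes "\<gamma> > 0" "regular_path w" "0 \<le> t"
  shows "summable (\<lambda>k. step_fun \<gamma> (t + Zs w k) - step_fun \<gamma> (real k))"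
proof (rule summable_comparison_test_ev[OF _ summable_osc[OF assms(1)]])
  show "eventually (\<lambda>k. norm (step_fun \<gamma> (t + Zs w k) - step_fun \<gamma> (real k)) \<le> osc \<gamma> k) sequentially"
    using eventually_osc_bound[OF assms(1,2), of t] by eventually_elim (use assms(3) in auto)
qed

lemma summable_Vf_Suc:
  assumes "\<gamma> > 0" "regular_path w" "0 \<le> t"
  shows "summable (\<lambda>j. step_fun \<gamma> (t + Zs w (Suc j)) - step_fun \<gamma> (real (Suc j)))"
  using summable_Vf[OF assms] by (subst summable_Suc_iff)

lemma Vf_antimono:
  assumes g: "\<gamma> > 0" and w: "regular_path w" and "0 \<le> s" "s \<le> t"
  shows "Vf \<gamma> t w \<le> Vf \<gamma> s w"
  unfolding Vf_def
proof (intro suminf_le summable_Vf_Suc g w)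
  fix j
  have "0 < Zs w (Suc j)" using w by (intro Zs_pos) (auto simp: regular_path_def)
  then show "step_fun \<gamma> (t + Zs w (Suc j)) - step_fun \<gamma> (real (Suc j)) \<le> step_fun \<gamma> (s + Zs w (Suc j)) - step_fun \<gamma> (real (Suc j))"
    using assms by (intro diff_right_mono step_fun_antimono) auto
qed (use assms in auto)

text \<open>All terms are weakly monotone in the shift, so it is enough that one of them, the
  \<open>j\<close>-th, crosses a jump point.\<close>

lemma Vf_strict_antimono:
  assumes g: "\<gamma> > 0" and w: "regular_path w" and "0 \<le> s" "s \<le> t"
    and hit: "s + Zs w (Suc j) < \<gamma> * 2 powr of_int m" "\<gamma> * 2 powr of_int m \<le> t + Zs w (Suc j)"
  shows "Vf \<gamma> t w < Vf \<gamma> s w"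
proof -
  let ?f = "\<lambda>t j. step_fun \<gamma> (t + Zs w (Suc j)) - step_fun \<gamma> (real (Suc j))"
  have pos: "0 < Zs w (Suc j)" for j using w by (intro Zs_pos) (auto simp: regular_path_def)
  have sm: "summable (?f s)" "summable (?f t)" using assms(3,4) by (blast intro: summable_Vf_Suc[OF g w] order_trans)+
  have "0 < (\<Sum>j. ?f s j - ?f t j)"
  proof (rule suminf_pos2[of _ j])
    show "summable (\<lambda>j. ?f s j - ?f t j)" by (intro summable_diff sm)
    show "0 \<le> ?f s j - ?f t j" for j
      using pos[of j] assms by (auto intro!: step_fun_antimono)
    show "0 < ?f s j - ?f t j"
      using step_fun_strict[OF g _ hit] pos[of j] assms by auto
  qed
  also have "\<dots> = Vf \<gamma> s w - Vf \<gamma> t w"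
    unfolding Vf_def by (rule suminf_diff[symmetric, OF sm])
  finally show ?thesis by simp
qed

text \<open>Each term is right continuous, and far terms are dominated by \<open>osc\<close>
  uniformly in \<open>t < 1\<close>, so the limit passes through the series.\<close>

lemma Vf_right_continuous:
  assumes g: "\<gamma> > 0" and w: "regular_path w"
  shows "((\<lambda>t. Vf \<gamma> t w) \<longlongrightarrow> Vf \<gamma> 0 w) (at_right 0)"
proof -
  let ?f = "\<lambda>j t. step_fun \<gamma> (t + Zs w (Suc j)) - step_fun \<gamma> (real (Suc j))"
  have pos: "0 < Zs w (Suc j)" for j using w by (intro Zs_pos) (auto simp: regular_path_def)
  have t1: "eventually (\<lambda>t::real. t \<in> {0<..<1}) (at_right 0)"
    by (rule eventually_at_rightI[of 0 1]) auto
  obtain K where K: "\<And>k t. k \<ge> K \<Longrightarrow> t \<in> {0..1} \<Longrightarrow> \<bar>step_fun \<gamma> (t + Zs w k) - step_fun \<gamma> (real k)\<bar> \<le> osc \<gamma> k"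
    using eventually_osc_bound[OF g w, of 1] unfolding eventually_sequentially by blast
  have "(\<lambda>t. \<Sum>j. ?f j t) = (\<lambda>t. Vf \<gamma> t w)" by (simp add: Vf_def)
  moreover have "((\<lambda>t. \<Sum>j. ?f j t) \<longlongrightarrow> (\<Sum>j. ?f j 0)) (at_right 0)"
  proof (rule tannerys_theorem[THEN conjunct2, THEN conjunct2])
    show "((\<lambda>t. ?f j t) \<longlongrightarrow> ?f j 0) (at_right 0)" for j
      using step_fun_right_continuous[OF g pos[of j]] by (intro tendsto_intros) auto
    show "eventually (\<lambda>(j, t). norm (?f j t) \<le> osc \<gamma> (Suc j)) (sequentially \<times>\<^sub>F at_right 0)"
      unfolding eventually_prod_filter
    proof (intro exI conjI allI impI)
      show "eventually (\<lambda>j. j \<ge> K) sequentially" by (rule eventually_ge_at_top)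
      show "eventually (\<lambda>t::real. t \<in> {0<..<1}) (at_right 0)" by (rule t1)
      show "case (j, t) of (j, t) \<Rightarrow> norm (?f j t) \<le> osc \<gamma> (Suc j)" if "j \<ge> K" "t \<in> {0<..<1}" for j t
        using K[of "Suc j" t] that by simp
    qed
    show "summable (\<lambda>j. osc \<gamma> (Suc j))" using summable_osc[OF g] by (subst summable_Suc_iff)
  qed auto
  ultimately show ?thesis by (simp add: Vf_def)
qed

text \<open>\<open>comb_seq n w' w\<close> takes its first \<open>n\<close> coordinates from
  \<open>w'\<close> and continues with \<open>w\<close>, so the walk restarts at
  \<open>Zs w' n\<close>.\<close>

lemma Zs_comb_seq: "Zs (comb_seq n w' w) (n + j) = Zs w' n + Zs w j"
proof -
  have "Zs (comb_seq n w' w) (n + j) = (\<Sum>i<n. comb_seq n w' w i) + (\<Sum>i<j. comb_seq n w' w (n + i))"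
    unfolding Zs_def lessThan_atLeast0
    by (subst sum.atLeastLessThan_concat[symmetric, of 0 n]) (auto simp: sum.shift_bounds_nat_ivl[of _ 0 n j, simplified] add.commute)
  then show ?thesis by (simp add: Zs_def comb_seq_def)
qed

lemma Zs_comb_seq_le: "k \<le> n \<Longrightarrow> Zs (comb_seq n w' w) k = Zs w' k"
  unfolding Zs_def by (intro sum.cong) (auto simp: comb_seq_def)

lemma Arg_sum_step_fun: "Arg_sum r \<gamma> = (\<Sum>k=1..r. step_fun \<gamma> (real k))"
  by (simp add: Arg_sum_def step_fun_def)

text \<open>After the split the series for \<open>Yf\<close> and \<open>Vf\<close> follow the same
  walk, but their compensators have indices differing by \<open>r + 1\<close>; comparing them leaves
  a finite sum.\<close>

lemma Yf_comb_seq: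
  assumes g: "\<gamma> > 0" and w: "regular_path w" and T: "0 \<le> Zs w' (Suc r)"
  shows "Yf \<gamma> r (comb_seq (Suc r) w' w) = step_fun \<gamma> (Zs w' (Suc r)) + Arg_sum r \<gamma> + Vf \<gamma> (Zs w' (Suc r)) w"
proof -
  let ?T = "Zs w' (Suc r)"
  let ?h = "\<lambda>k. step_fun \<gamma> (real k)"
  \<comment> \<open>The compensators tend to 0, so their differences at distance
    \<open>Suc r\<close> sum to the first \<open>Suc r\<close> values.\<close>
  have tel: "(\<lambda>j. ?h (Suc j) - ?h (Suc j + Suc r)) sums (\<Sum>k=1..Suc r. ?h k)"
  proof (induction r)
    case 0
    have "(\<lambda>j. ?h (Suc j) - ?h (Suc (Suc j))) sums (?h (Suc 0) - 0)"
      by (intro telescope_sums') (use LIMSEQ_Suc[OF step_fun_seq_tendsto_0] in auto)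
    then show ?case by simp
  next
    case (Suc r)
    have "(\<lambda>j. ?h (Suc j + Suc r) - ?h (Suc (Suc j + Suc r))) sums (?h (Suc 0 + Suc r) - 0)"
      using telescope_sums'[of "\<lambda>j. ?h (Suc j + Suc r)" 0] LIMSEQ_ignore_initial_segment[OF step_fun_seq_tendsto_0, of \<gamma> "Suc (Suc r)"]
      by (simp add: algebra_simps)
    from sums_add[OF Suc this] show ?case by simp
  qed
  have "(\<lambda>j. step_fun \<gamma> (?T + Zs w (Suc j)) - ?h (Suc j)) sums Vf \<gamma> ?T w"
    unfolding Vf_def by (intro summable_sums summable_Vf_Suc g w T)
  from sums_add[OF this tel]
  have "(\<lambda>j. step_fun \<gamma> (?T + Zs w (Suc j)) - ?h (Suc j + Suc r)) sums (Vf \<gamma> ?T w + (\<Sum>k=1..Suc r. ?h k))"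
    by simp
  moreover have eq: "step_fun \<gamma> (Zs (comb_seq (Suc r) w' w) (j + r + 1)) - ?h (j + r + 1) = step_fun \<gamma> (?T + Zs w j) - ?h (j + Suc r)" for j
    using Zs_comb_seq[of "Suc r" w' w j] by (simp add: algebra_simps)
  ultimately have "(\<lambda>j. step_fun \<gamma> (Zs (comb_seq (Suc r) w' w) (Suc j + r + 1)) - ?h (Suc j + r + 1)) sums
    (Vf \<gamma> ?T w + (\<Sum>k=1..Suc r. ?h k))" by (simp only: eq)
  \<comment> \<open>The term with index \<open>r + 1\<close> is put back at the front; its
    compensator removes the last summand and turns the finite sum into
    \<open>Arg_sum r \<gamma>\<close>.\<close>
  from sums_Suc[OF this] Zs_comb_seq[of "Suc r" w' w 0]
  have "(\<lambda>j. step_fun \<gamma> (Zs (comb_seq (Suc r) w' w) (j + r + 1)) - ?h (j + r + 1)) sums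
    (Vf \<gamma> ?T w + (\<Sum>k=1..Suc r. ?h k) + (step_fun \<gamma> ?T - ?h (Suc r)))"
    by (simp add: Zs_def)
  then show ?thesis unfolding Yf_def Arg_sum_step_fun
    by (simp add: sums_iff)
qed

lemma Zs_measurable[measurable]:
  "(\<lambda>w. Zs w k) \<in> borel_measurable (PiM UNIV (\<lambda>_. borel))"
  unfolding Zs_def by measurable

subsection \<open>Sequences of independent exponential variables\<close>

definition Exp1 :: "real measure" where
  "Exp1 = density lborel (exponential_density 1)"

definition Sexp :: "(nat \<Rightarrow> real) measure" where
  "Sexp = PiM UNIV (\<lambda>_. Exp1)"

lemma sets_Exp1[measurable_cong, simp]: "sets Exp1 = sets borel"
  by (simp add: Exp1_def)

lemma space_Exp1[simp]: "space Exp1 = UNIV"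
  by (simp add: Exp1_def)

lemma sets_Sexp[measurable_cong]: "sets Sexp = sets (PiM UNIV (\<lambda>_. borel))"
  unfolding Sexp_def by (intro sets_PiM_cong) auto

lemma space_Sexp[simp]: "space Sexp = UNIV"
  by (simp add: Sexp_def space_PiM PiE_UNIV_domain)

lemma prob_space_Exp1: "prob_space Exp1"
  unfolding Exp1_def by (rule prob_space_exponential_density) simp

interpretation E1: prob_space Exp1 by (rule prob_space_Exp1)

interpretation SS: sequence_space Exp1
  by unfold_locales

interpretation Se: prob_space Sexp
  unfolding Sexp_def by (rule SS.P.prob_space_axioms)

lemma distr_Sexp_component: "distr Sexp borel (\<lambda>w. w i) = Exp1"
proof -
  have "distr Sexp borel (\<lambda>w. w i) = distr Sexp Exp1 (\<lambda>w. w i)"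
    by (intro distr_cong) auto
  also have "\<dots> = Exp1" unfolding Sexp_def by (rule SS.PiM_component) simp
  finally show ?thesis .
qed

lemma indep_components: "Se.indep_vars (\<lambda>_. borel) (\<lambda>i w. w i) UNIV"
proof (subst Se.indep_vars_iff_distr_eq_PiM)
  have "distr Sexp (PiM UNIV (\<lambda>_. borel)) (\<lambda>x. \<lambda>i\<in>UNIV. x i) = distr Sexp Sexp (\<lambda>x. x)"
    by (intro distr_cong) (auto simp: sets_Sexp)
  then show "distr Sexp (PiM UNIV (\<lambda>_. borel)) (\<lambda>x. \<lambda>i\<in>UNIV. x i) = PiM UNIV (\<lambda>i. distr Sexp borel (\<lambda>w. w i))"
    unfolding distr_Sexp_component by (simp add: Sexp_def)
qed auto

lemma distributed_component: "distributed Sexp lborel (\<lambda>w. w i) (exponential_density 1)"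
proof -
  have "distr Sexp lborel (\<lambda>w. w i) = distr Sexp borel (\<lambda>w. w i)"
    by (intro distr_cong) auto
  then show ?thesis by (simp add: distributed_def distr_Sexp_component) (simp add: Exp1_def)
qed

lemma distributed_Zs: "distributed Sexp lborel (\<lambda>w. Zs w (Suc r)) (erlang_density r 1)"
proof -
  have "distributed Sexp lborel (\<lambda>w. \<Sum>i<Suc r. w i) (erlang_density (card {..<Suc r} - 1) 1)"
    by (rule Se.exponential_distributed_sum)
       (auto intro: distributed_component Se.indep_vars_subset[OF indep_components])
  then show ?thesis by (simp add: Zs_def)
qed

section \<open>Interval probabilities and deviations of the partial sums\<close>

lemma nn_integral_power_Icc:
  assumes "0 \<le> a" "a \<le> b"
  shows "(\<integral>\<^sup>+x. ennreal (x ^ r / fact r) * indicator {a..b} x \<partial>lborel) = ennreal ((b ^ Suc r - a ^ Suc r) / fact (Suc r))"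
proof -
  have "(\<integral>\<^sup>+x. ennreal (x ^ r / fact r) * indicator {a..b} x \<partial>lborel)
    = ennreal (b ^ Suc r / fact (Suc r) - a ^ Suc r / fact (Suc r))"
  proof (rule nn_integral_FTC_Icc)
    show "((\<lambda>x. x ^ Suc r / fact (Suc r)) has_real_derivative x ^ r / fact r) (at x)" for x :: real
    proof -
      have "((\<lambda>x. x ^ Suc r / fact (Suc r)) has_real_derivative (real (Suc r) * x ^ r) / fact (Suc r)) (at x)"
        by (intro DERIV_cdivide) (use DERIV_pow[of "Suc r" x] in \<open>simp del: of_nat_Suc power_Suc\<close>)
      then show ?thesis by (simp del: of_nat_Suc)
    qed
  qed (use assms in auto)
  then show ?thesis by (simp add: diff_divide_distrib)
qed

text \<open>On \<open>[a, b)\<close> the Erlang density lies between \<open>exp (-b)\<close> times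
  \<open>x ^ r / fact r\<close> and \<open>x ^ r / fact r\<close> itself. For \<open>b\<close> near
  0 the two bounds agree asymptotically.\<close>

lemma prob_Zs_le:
  assumes "0 \<le> a" "a \<le> b"
  shows "Se.prob {w. a \<le> Zs w (Suc r) \<and> Zs w (Suc r) < b} \<le> (b ^ Suc r - a ^ Suc r) / fact (Suc r)"
    and "exp (-b) * ((b ^ Suc r - a ^ Suc r) / fact (Suc r)) \<le> Se.prob {w. a \<le> Zs w (Suc r) \<and> Zs w (Suc r) < b}"
proof -
  have ab: "a ^ Suc r \<le> b ^ Suc r" using assms by (intro power_mono)
  have eq: "emeasure Sexp {w. a \<le> Zs w (Suc r) \<and> Zs w (Suc r) < b} =
     (\<integral>\<^sup>+x. ennreal (erlang_density r 1 x) * indicator {a..<b} x \<partial>lborel)"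
    using distributed_emeasure[OF distributed_Zs, of "{a..<b}" r] by (simp add: vimage_def)
  also have "\<dots> \<le> (\<integral>\<^sup>+x. ennreal (x ^ r / fact r) * indicator {a..b} x \<partial>lborel)"
    using assms by (intro nn_integral_mono) (auto simp: erlang_density_def divide_right_mono mult_left_le split: split_indicator)
  finally show "Se.prob {w. a \<le> Zs w (Suc r) \<and> Zs w (Suc r) < b} \<le> (b ^ Suc r - a ^ Suc r) / fact (Suc r)"
    using ab by (simp add: nn_integral_power_Icc assms Se.emeasure_eq_measure)
  have "ennreal (exp (-b) * ((b ^ Suc r - a ^ Suc r) / fact (Suc r)))
     = ennreal (exp (-b)) * (\<integral>\<^sup>+x. ennreal (x ^ r / fact r) * indicator {a..b} x \<partial>lborel)"
    by (simp only: nn_integral_power_Icc[OF assms] ennreal_mult'[OF exp_ge_zero])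
  also have "\<dots> = (\<integral>\<^sup>+x. ennreal (exp (-b)) * (ennreal (x ^ r / fact r) * indicator {a..b} x) \<partial>lborel)"
    by (rule nn_integral_cmult[symmetric]) auto
  also have "\<dots> \<le> (\<integral>\<^sup>+x. ennreal (erlang_density r 1 x) * indicator {a..<b} x \<partial>lborel)"
  proof (intro nn_integral_mono_AE)
    \<comment> \<open>The left side counts the endpoint \<open>b\<close>, the right side does not,
      so the inequality is only claimed almost everywhere.\<close>
    show "AE x in lborel. ennreal (exp (-b)) * (ennreal (x ^ r / fact r) * indicator {a..b} x) \<le> ennreal (erlang_density r 1 x) * indicator {a..<b} x"
      using AE_lborel_singleton[of b]
    proof eventually_elim
      case (elim x)
      show ?case
      proof (cases "x \<in> {a..<b}")
        case True
        have "exp (-b) * (x ^ r / fact r) \<le> exp (-x) * (x ^ r / fact r)"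
          using True assms by (intro mult_right_mono) auto
        also have "\<dots> = erlang_density r 1 x" using True assms by (simp add: erlang_density_def)
        finally show ?thesis using True assms by (simp add: ennreal_mult'[symmetric])
      qed (use elim in \<open>auto simp: indicator_def\<close>)
    qed
  qed
  finally show "exp (-b) * ((b ^ Suc r - a ^ Suc r) / fact (Suc r)) \<le> Se.prob {w. a \<le> Zs w (Suc r) \<and> Zs w (Suc r) < b}"
    unfolding eq[symmetric] by (simp add: Se.emeasure_eq_measure)
qed

lemma prob_Zs_less_nonneg: "0 < k \<Longrightarrow> 0 \<le> t \<Longrightarrow> Se.prob {w. 0 \<le> Zs w k \<and> Zs w k < t} \<le> t ^ k / fact k"
  using prob_Zs_le(1)[of 0 t "k - 1"] by (simp add: zero_power)

text \<open>The fourth power is expanded into raw Erlang moments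
  \<open>fact (r + i) / fact r\<close>, with \<open>k = Suc r\<close>.\<close>

lemma fourth_moment_Zs:
  assumes k: "k > 0"
  shows "integrable Sexp (\<lambda>w. (Zs w k - real k) ^ 4)" (is ?A)
    and "Se.expectation (\<lambda>w. (Zs w k - real k) ^ 4) = 3 * real k ^ 2 + 6 * real k" (is ?B)
proof -
  obtain r where r: "k = Suc r" using k by (cases k) auto
  let ?Z = "\<lambda>w. Zs w k"
  have mom: "has_bochner_integral Sexp (\<lambda>w. ?Z w ^ i) (fact (r + i) / fact r)" for i
    using Se.has_bochner_integral_erlang_ith_moment[OF _ distributed_Zs[of r], of i] by (simp add: r)
  have "has_bochner_integral Sexp (\<lambda>w. ?Z w ^ 4 - 4 * real k * ?Z w ^ 3 + 6 * real k ^ 2 * ?Z w ^ 2 - 4 * real k ^ 3 * ?Z w ^ 1 + real k ^ 4 * ?Z w ^ 0)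
    (fact (r + 4) / fact r - 4 * real k * (fact (r + 3) / fact r) + 6 * real k ^ 2 * (fact (r + 2) / fact r)
      - 4 * real k ^ 3 * (fact (r + 1) / fact r) + real k ^ 4 * (fact (r + 0) / fact r))"
    by (intro has_bochner_integral_add has_bochner_integral_diff has_bochner_integral_mult_right mom)
  moreover have "?Z w ^ 4 - 4 * real k * ?Z w ^ 3 + 6 * real k ^ 2 * ?Z w ^ 2 - 4 * real k ^ 3 * ?Z w ^ 1 + real k ^ 4 * ?Z w ^ 0
    = (?Z w - real k) ^ 4" for w by (simp add: power4_eq_xxxx power3_eq_cube power2_eq_square) algebra
  moreover have "fact (r + 4) / fact r - 4 * real k * (fact (r + 3) / fact r) + 6 * real k ^ 2 * (fact (r + 2) / fact r)
      - 4 * real k ^ 3 * (fact (r + 1) / fact r) + real k ^ 4 * (fact (r + 0) / fact r) = 3 * real k ^ 2 + 6 * real k"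
  proof -
    have f: "fact (r + 1) / fact r = real r + 1" "fact (r + 2) / fact r = (real r + 2) * (real r + 1)"
      "fact (r + 3) / fact r = (real r + 3) * (real r + 2) * (real r + 1)"
      "fact (r + 4) / fact r = (real r + 4) * (real r + 3) * (real r + 2) * (real r + 1)" "fact (r + 0) / fact r = (1::real)"
      by (simp_all add: eval_nat_numeral field_simps)
    show ?thesis unfolding f r by (simp add: power4_eq_xxxx power3_eq_cube power2_eq_square) algebra
  qed
  ultimately have *: "has_bochner_integral Sexp (\<lambda>w. (?Z w - real k) ^ 4) (3 * real k ^ 2 + 6 * real k)"
    by simp
  show ?A ?B using * by (auto simp: has_bochner_integral_iff)
qed

lemma Collect_in_Sexp: "Measurable.pred Sexp P \<Longrightarrow> {w. P w} \<in> sets Sexp"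
  by (simp add: pred_def)

text \<open>Markov's inequality for the fourth power: a moment of order \<open>k^2\<close> against
  the threshold \<open>k^(7/2)\<close>. The resulting exponent is below -1, hence summable, whereas
  the variance would only give \<open>k^(-3/4)\<close>. The 9 is 3 + 6, from
  \<open>k <= k^2\<close>.\<close>

lemma prob_deviation:
  assumes k: "k > 0"
  shows "Se.prob {w. \<not> \<bar>Zs w k - real k\<bar> \<le> real k powr (7/8)} \<le> 9 * real k powr (-3/2)"
proof -
  have "Se.prob {w. \<not> \<bar>Zs w k - real k\<bar> \<le> real k powr (7/8)} \<le> Se.prob {w \<in> space Sexp. real k powr (7/2) \<le> (Zs w k - real k) ^ 4}"
  proof (rule Se.finite_measure_mono)
    have "(real k powr (7/8)) ^ 4 \<le> x ^ 4" if "\<not> \<bar>x\<bar> \<le> real k powr (7/8)" for x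
      using power_mono[of "real k powr (7/8)" "\<bar>x\<bar>" 4] that by simp
    moreover have "(real k powr (7/8)) ^ 4 = real k powr (7/2)"
      using k by (simp add: powr_powr flip: powr_realpow)
    ultimately show "{w. \<not> \<bar>Zs w k - real k\<bar> \<le> real k powr (7/8)} \<subseteq> {w \<in> space Sexp. real k powr (7/2) \<le> (Zs w k - real k) ^ 4}"
      by auto
  qed measurable
  also have "\<dots> \<le> Se.expectation (\<lambda>w. (Zs w k - real k) ^ 4) / real k powr (7/2)"
    by (rule integral_Markov_inequality_measure[where A = "space Sexp" and u = "\<lambda>w. (Zs w k - real k) ^ 4", simplified])
       (use k fourth_moment_Zs sets.top[of Sexp] in auto)
  also have "\<dots> \<le> (9 * real k powr 2) / real k powr (7/2)"
  proof (intro divide_right_mono)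
    have "real k \<le> real k ^ 2" using k by (simp add: power2_eq_square)
    then show "Se.expectation (\<lambda>w. (Zs w k - real k) ^ 4) \<le> 9 * real k powr 2"
      using k by (simp add: fourth_moment_Zs)
  qed simp
  also have "\<dots> = 9 * real k powr (2 - 7/2)" unfolding powr_diff by simp
  finally show ?thesis by simp
qed

lemma AE_pos: "AE w in Sexp. \<forall>i. 0 < w i"
proof -
  have "AE x in Exp1. 0 < x"
    unfolding Exp1_def using AE_lborel_singleton[of "0::real"]
    by (subst AE_density) (auto simp: erlang_density_def elim!: eventually_mono)
  then have "AE w in Sexp. 0 < w i" for i
    unfolding Sexp_def by (intro SS.AE_component) auto
  then show ?thesis by (simp add: AE_all_countable)
qed

lemma AE_regular_path: "AE w in Sexp. regular_path w"
proof -
  have sm: "summable (\<lambda>k. 9 * real k powr (-3/2))"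
    by (intro summable_mult) (simp add: summable_real_powr_iff)
  have "AE w in Sexp. eventually (\<lambda>k. w \<in> space Sexp - {w. \<not> \<bar>Zs w k - real k\<bar> \<le> real k powr (7/8)}) sequentially"
  proof (rule borel_cantelli_AE1)
    show "summable (\<lambda>k. Se.prob {w. \<not> \<bar>Zs w k - real k\<bar> \<le> real k powr (7/8)})"
    proof (rule summable_comparison_test_ev[OF _ sm])
      show "eventually (\<lambda>k. norm (Se.prob {w. \<not> \<bar>Zs w k - real k\<bar> \<le> real k powr (7/8)}) \<le> 9 * real k powr (-3/2)) sequentially"
        using eventually_gt_at_top[of 0] by eventually_elim (use prob_deviation in auto)
    qed
    show "{w. \<not> \<bar>Zs w k - real k\<bar> \<le> real k powr (7/8)} \<in> sets Sexp" for k
      by (intro Collect_in_Sexp) measurable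
  qed (auto simp: Se.emeasure_eq_measure less_top[symmetric])
  with AE_pos show ?thesis
    by eventually_elim (auto simp: regular_path_def elim: eventually_mono)
qed

text \<open>The exponent -3/2 is split as -5/4 - 1/4: the first part keeps the union bound over
  \<open>k >= K\<close> summable, the second supplies the decay in \<open>K\<close>.\<close>

lemma prob_tail_deviation:
  obtains C where "0 \<le> C" "\<And>K. 0 < K \<Longrightarrow> Se.prob {w. \<exists>k\<ge>K. \<not> \<bar>Zs w k - real k\<bar> \<le> real k powr (7/8)} \<le> C * real K powr (-1/4)"
proof -
  let ?B = "\<lambda>k. {w. \<not> \<bar>Zs w k - real k\<bar> \<le> real k powr (7/8)}"
  have sm: "summable (\<lambda>k. 9 * real k powr (-5/4))"
    by (intro summable_mult) (simp add: summable_real_powr_iff)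
  show ?thesis
  proof (rule that[of "\<Sum>k. 9 * real k powr (-5/4)"])
    show "0 \<le> (\<Sum>k. 9 * real k powr (-5/4))" by (intro suminf_nonneg sm) auto
    fix K :: nat assume K: "0 < K"
    have smK: "summable (\<lambda>j. 9 * real (j + K) powr (-5/4))"
      using sm by (subst summable_iff_shift)
    have b: "Se.prob (?B (j + K)) \<le> 9 * real (j + K) powr (-5/4) * real K powr (-1/4)" for j
    proof -
      have "Se.prob (?B (j + K)) \<le> 9 * real (j + K) powr (-3/2)"
        using K by (intro prob_deviation) auto
      also have "\<dots> = 9 * real (j + K) powr (-5/4) * real (j + K) powr (-1/4)"
        unfolding mult.assoc powr_add[symmetric] by simp
      also have "\<dots> \<le> 9 * real (j + K) powr (-5/4) * real K powr (-1/4)"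
        using K by (intro mult_left_mono powr_mono2') auto
      finally show ?thesis .
    qed
    have smb: "summable (\<lambda>j. 9 * real (j + K) powr (-5/4) * real K powr (-1/4))"
      using smK by (rule summable_mult2)
    have smp: "summable (\<lambda>j. Se.prob (?B (j + K)))"
      by (rule summable_comparison_test[OF _ smb]) (use b in auto)
    have "{w. \<exists>k\<ge>K. \<not> \<bar>Zs w k - real k\<bar> \<le> real k powr (7/8)} = (\<Union>j. ?B (j + K))"
    proof safe
      fix w k assume "K \<le> k" "\<not> \<bar>Zs w k - real k\<bar> \<le> real k powr (7/8)"
      then show "w \<in> (\<Union>j. ?B (j + K))" by (intro UN_I[of "k - K"]) auto
    next
      fix w j assume "\<not> \<bar>Zs w (j + K) - real (j + K)\<bar> \<le> real (j + K) powr (7/8)"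
      then show "\<exists>k\<ge>K. \<not> \<bar>Zs w k - real k\<bar> \<le> real k powr (7/8)" by (intro exI[of _ "j + K"]) auto
    qed
    then have "Se.prob {w. \<exists>k\<ge>K. \<not> \<bar>Zs w k - real k\<bar> \<le> real k powr (7/8)} \<le> (\<Sum>j. Se.prob (?B (j + K)))"
    proof (simp only:, intro Se.finite_measure_subadditive_countably smp)
      have "?B (j + K) \<in> sets Sexp" for j by (intro Collect_in_Sexp) measurable
      then show "range (\<lambda>j. ?B (j + K)) \<subseteq> sets Sexp" by blast
    qed
    also have "\<dots> \<le> (\<Sum>j. 9 * real (j + K) powr (-5/4) * real K powr (-1/4))"
      by (intro suminf_le b smp smb)
    also have "\<dots> = (\<Sum>j. 9 * real (j + K) powr (-5/4)) * real K powr (-1/4)"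
      by (rule suminf_mult2[symmetric, OF smK])
    also have "\<dots> \<le> (\<Sum>k. 9 * real k powr (-5/4)) * real K powr (-1/4)"
      using suminf_split_initial_segment[OF sm, of K] by (intro mult_right_mono) (auto intro!: sum_nonneg)
    finally show "Se.prob {w. \<exists>k\<ge>K. \<not> \<bar>Zs w k - real k\<bar> \<le> real k powr (7/8)} \<le> (\<Sum>k. 9 * real k powr (-5/4)) * real K powr (-1/4)" .
  qed
qed

subsection \<open>The contribution of moderate first terms\<close>

text \<open>Up to index \<open>K\<close> the nonnegative compensators are dropped; beyond
  \<open>K\<close> each compensated term is at most \<open>osc\<close>.\<close>

lemma Yf_le:
  assumes g: "\<gamma> > 0" and w: "regular_path w" and K: "r < K"
    and dv: "\<And>k. k > K \<Longrightarrow> dev k \<le> real k / 2"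
    and nb: "\<And>k. k > K \<Longrightarrow> \<bar>Zs w k - real k\<bar> \<le> real k powr (7/8)"
  shows "Yf \<gamma> r w \<le> step_fun \<gamma> (Zs w (Suc r)) + (\<Sum>k\<in>{Suc (Suc r)..K}. 2 / Zs w k) + (\<Sum>j. osc \<gamma> (j + Suc K))"
proof -
  let ?h = "\<lambda>k. step_fun \<gamma> (Zs w k) - step_fun \<gamma> (real k)"
  have pos: "0 < Zs w k" if "k > 0" for k using w that by (intro Zs_pos) (auto simp: regular_path_def)
  have sm0: "summable ?h" using summable_Vf[OF g w, of 0] by simp
  have sm: "summable (\<lambda>j. ?h (j + Suc r))" using sm0 by (subst summable_iff_shift)
  have smK: "summable (\<lambda>j. ?h (j + Suc K))" using sm0 by (subst summable_iff_shift)
  have smo: "summable (\<lambda>j. osc \<gamma> (j + Suc K))" using summable_osc[OF g] by (subst summable_iff_shift)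
  have "Yf \<gamma> r w = (\<Sum>j. ?h (j + Suc r))" by (simp add: Yf_def)
  also have "\<dots> = (\<Sum>j. ?h ((j + (K - r)) + Suc r)) + (\<Sum>j<K - r. ?h (j + Suc r))"
    by (rule suminf_split_initial_segment[OF sm])
  also have "(\<Sum>j. ?h ((j + (K - r)) + Suc r)) = (\<Sum>j. ?h (j + Suc K))"
    using K by (intro suminf_cong) (simp add: algebra_simps)
  also have "\<dots> \<le> (\<Sum>j. osc \<gamma> (j + Suc K))"
  proof (intro suminf_le smK smo)
    fix j
    have "\<bar>Zs w (j + Suc K) - real (j + Suc K)\<bar> \<le> dev (j + Suc K)"
      using nb[of "j + Suc K"] by (simp add: dev_def)
    then have "\<bar>?h (j + Suc K)\<bar> \<le> osc \<gamma> (j + Suc K)"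
      using g dv[of "j + Suc K"] by (intro osc_bound) auto
    then show "?h (j + Suc K) \<le> osc \<gamma> (j + Suc K)" by linarith
  qed
  also have "(\<Sum>j<K - r. ?h (j + Suc r)) \<le> (\<Sum>j<K - r. step_fun \<gamma> (Zs w (j + Suc r)))"
    by (intro sum_mono) (simp add: step_fun_nonneg)
  also have "\<dots> = (\<Sum>k\<in>{Suc r..K}. step_fun \<gamma> (Zs w k))"
    using K by (intro sum.reindex_bij_witness[of _ "\<lambda>k. k - Suc r" "\<lambda>j. j + Suc r"]) auto
  also have "\<dots> = step_fun \<gamma> (Zs w (Suc r)) + (\<Sum>k\<in>{Suc (Suc r)..K}. step_fun \<gamma> (Zs w k))"
    using K by (subst sum.atLeast_Suc_atMost) auto
  also have "(\<Sum>k\<in>{Suc (Suc r)..K}. step_fun \<gamma> (Zs w k)) \<le> (\<Sum>k\<in>{Suc (Suc r)..K}. 2 / Zs w k)"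
    by (intro sum_mono step_fun_le pos) auto
  finally show ?thesis by simp
qed

text \<open>The left side is one term of the exponential series at \<open>real k\<close>.\<close>

lemma power_self_le_fact_exp: "real k ^ k / fact k \<le> exp 1 ^ k"
proof -
  have "(\<Sum>n\<in>{k}. real k ^ n / fact n) \<le> (\<Sum>n. real k ^ n / fact n)"
    by (intro sum_le_suminf) (use summable_exp_generic[of "real k"] in \<open>auto simp: scaleR_conv_of_real field_simps\<close>)
  also have "\<dots> = exp (real k)" by (simp add: exp_def scaleR_conv_of_real field_simps)
  finally show ?thesis by (simp flip: exp_of_nat_mult)
qed

text \<open>By \<open>power_self_le_fact_exp\<close> the event for a single \<open>k\<close> has
  probability at most \<open>q ^ k\<close> with \<open>q = exp 1 / sqrt x\<close>. The hypothesis
  gives \<open>q <= 1 / 2\<close>, so the geometric tail from \<open>L\<close> on costs a factor 2,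
  uniformly in \<open>K\<close>.\<close>

lemma prob_small_Zs:
  assumes x: "sqrt x \<ge> 2 * exp 1"
  shows "Se.prob {w. \<exists>k\<in>{L..K}. 0 \<le> Zs w k \<and> Zs w k < real k / sqrt x} \<le> 2 * (exp 1 / sqrt x) ^ L"
\<comment> \<open>For \<open>L = 0\<close> the bound is 2 and trivial; otherwise all
  \<open>k\<close> are positive, as \<open>prob_Zs_less_nonneg\<close> requires.\<close>
proof (cases "L = 0")
  case True
  then show ?thesis using Se.prob_le_1 by (auto intro: order_trans)
next
  case False
  let ?q = "exp 1 / sqrt x"
  have sx: "sqrt x > 0" using x by (smt (verit) exp_gt_zero)
  have q: "0 \<le> ?q" "?q \<le> 1 / 2" using x sx by (auto simp: field_simps)
  have "{w. \<exists>k\<in>{L..K}. 0 \<le> Zs w k \<and> Zs w k < real k / sqrt x} = (\<Union>k\<in>{L..K}. {w. 0 \<le> Zs w k \<and> Zs w k < real k / sqrt x})"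
    by auto
  also have "Se.prob \<dots> \<le> (\<Sum>k\<in>{L..K}. Se.prob {w. 0 \<le> Zs w k \<and> Zs w k < real k / sqrt x})"
    by (intro Se.finite_measure_subadditive_finite) (auto intro!: Collect_in_Sexp)
  also have "\<dots> \<le> (\<Sum>k\<in>{L..K}. ?q ^ k)"
  proof (intro sum_mono)
    fix k assume k: "k \<in> {L..K}"
    have "Se.prob {w. 0 \<le> Zs w k \<and> Zs w k < real k / sqrt x} \<le> (real k / sqrt x) ^ k / fact k"
      using k False sx by (intro prob_Zs_less_nonneg) auto
    also have "\<dots> = (real k ^ k / fact k) / sqrt x ^ k" by (simp add: power_divide)
    also have "\<dots> \<le> exp 1 ^ k / sqrt x ^ k"
      using sx by (intro divide_right_mono power_self_le_fact_exp) auto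
    finally show "Se.prob {w. 0 \<le> Zs w k \<and> Zs w k < real k / sqrt x} \<le> ?q ^ k" by (simp add: power_divide)
  qed
  also have "\<dots> \<le> (\<Sum>k\<in>{L..<L + K + 1}. ?q ^ k)"
    using q by (intro sum_mono2) auto
  also have "\<dots> = (\<Sum>j<K + 1. ?q ^ (j + L))"
    by (intro sum.reindex_bij_witness[of _ "\<lambda>k. k + L" "\<lambda>j. j - L"]) auto
  also have "\<dots> \<le> (\<Sum>j<K + 1. ?q ^ L * (1 / 2) ^ j)"
    unfolding power_add mult.commute[of _ "?q ^ L"]
    using q by (intro sum_mono mult_left_mono power_mono) auto
  also have "\<dots> = ?q ^ L * (\<Sum>j<K + 1. (1 / 2) ^ j)" by (rule sum_distrib_left[symmetric])
  also have "\<dots> \<le> ?q ^ L * 2"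
  proof (intro mult_left_mono)
    have "(\<Sum>j<K + 1. (1 / 2 :: real) ^ j) \<le> (\<Sum>j. (1 / 2) ^ j)"
      by (intro sum_le_suminf summable_geometric) auto
    also have "(\<Sum>j. (1 / 2 :: real) ^ j) = 2" by (subst suminf_geometric) auto
    finally show "(\<Sum>j<K + 1. (1 / 2 :: real) ^ j) \<le> 2" .
  qed (use q in auto)
  finally show ?thesis by (simp only: mult.commute)
qed

text \<open>
  Let \<open>K\<close> be of order \<open>x\<^bsup>4r+8\<^esup>\<close> and \<open>L = 2r + 4\<close>. Outside three events of probability
  \<open>O(x\<^bsup>-r-2\<^esup>)\<close>, the terms beyond \<open>K\<close> sum to at most 1, those with \<open>L \<le> k \<le> K\<close> satisfy
  \<open>Z\<^sub>k \<ge> k/\<surd>x\<close> and so contribute \<open>O(\<surd>x log x)\<close>, and those with \<open>r + 2 \<le> k < L\<close> have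
  \<open>Z\<^sub>k \<ge> 16L/x\<close>.
\<close>

lemma prob_Yf_large_step_fun_small:
  assumes g: "\<gamma> > 0"
  shows "((\<lambda>x. x ^ Suc r * Se.prob {w. x < Yf \<gamma> r w \<and> step_fun \<gamma> (Zs w (Suc r)) \<le> x / 2}) \<longlongrightarrow> 0) at_top"
proof -
  obtain C where C: "0 \<le> C"
    "\<And>K. 0 < K \<Longrightarrow> Se.prob {w. \<exists>k\<ge>K. \<not> \<bar>Zs w k - real k\<bar> \<le> real k powr (7/8)} \<le> C * real K powr (-1/4)"
    using prob_tail_deviation by blast
  \<comment> \<open>With these exponents each bad event costs \<open>x\<close> to the power
    \<open>-(r + 2)\<close>: \<open>sqrt x ^ L\<close> is \<open>x ^ (r + 2)\<close>, and the
    exponent of \<open>K x\<close> is \<open>4 * (r + 2)\<close> against the rate -1/4 in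
    \<open>prob_tail_deviation\<close>. \<open>D\<close> collects the three constants.\<close>
  define L where "L = 2 * r + 4"
  define K where "K x = nat \<lceil>x\<rceil> ^ (4 * r + 8)" for x :: real
  define D where "D = C + 2 * exp 1 ^ L + (16 * real L) ^ (r + 2)"
  have "(\<lambda>m. \<Sum>j. osc \<gamma> (j + m)) \<longlonglongrightarrow> 0"
    by (rule suminf_exist_split2[OF summable_osc[OF g]])
  then have "eventually (\<lambda>m. (\<Sum>j. osc \<gamma> (j + m)) < 1) sequentially"
    by (rule order_tendstoD) auto
  then have "eventually (\<lambda>m. (\<Sum>j. osc \<gamma> (j + m)) < 1 \<and> dev m \<le> real m / 2 \<and> r < m) sequentially"
    using eventually_dev eventually_gt_at_top[of r] by eventually_elim auto
  then obtain m0 where m0: "\<And>m. m \<ge> m0 \<Longrightarrow> (\<Sum>j. osc \<gamma> (j + m)) < 1 \<and> dev m \<le> real m / 2 \<and> r < m"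
    unfolding eventually_sequentially by blast
  have l1: "((\<lambda>x::real. (2 * sqrt x + 1) / x) \<longlongrightarrow> 0) at_top" by real_asymp
  have l2: "((\<lambda>x::real. sqrt x * ln (x + 1) / x) \<longlongrightarrow> 0) at_top" by real_asymp
  \<comment> \<open>The budget for reaching \<open>x\<close>: \<open>x / 2\<close> from the first
    term, \<open>x / 8\<close> from the indices below \<open>L\<close>, and the remaining
    \<open>3 / 8 * x\<close> for the harmonic sum over \<open>{L..K x}\<close> and the tail bound
    1.\<close>
  have "((\<lambda>x::real. (2 * sqrt x + 1) / x + 2 * real (4 * r + 8) * (sqrt x * ln (x + 1) / x)) \<longlongrightarrow> 0 + 2 * real (4 * r + 8) * 0) at_top"
    by (intro tendsto_intros l1 l2)
  then have "eventually (\<lambda>x::real. (2 * sqrt x + 1) / x + 2 * real (4 * r + 8) * (sqrt x * ln (x + 1) / x) < 3 / 8) at_top"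
    by (rule order_tendstoD) auto
  moreover have "eventually (\<lambda>x. sqrt x \<ge> 2 * exp 1) at_top"
    by real_asymp
  moreover have "eventually (\<lambda>x. x \<ge> max 1 (real m0)) at_top" by (rule eventually_ge_at_top)
  ultimately have ev: "eventually (\<lambda>x. Se.prob {w. x < Yf \<gamma> r w \<and> step_fun \<gamma> (Zs w (Suc r)) \<le> x / 2} \<le> D / x ^ (r + 2)) at_top"
  proof eventually_elim
    case (elim x)
    have x1: "x \<ge> 1" and xm: "x \<ge> real m0" using elim by auto
    have n1: "x \<le> real (nat \<lceil>x\<rceil>)" "real (nat \<lceil>x\<rceil>) \<le> x + 1" "1 \<le> nat \<lceil>x\<rceil>" using x1 by linarith+
    have Kn: "nat \<lceil>x\<rceil> \<le> K x" unfolding K_def using n1 by (intro self_le_power) auto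
    have Kx: "x \<le> real (K x)" using Kn n1 by (meson of_nat_le_iff order_trans)
    have Km: "m0 \<le> K x" using Kx xm by linarith
    have K0: "0 < K x" using Kx x1 by (cases "K x") auto
    let ?B1 = "{w. \<exists>k\<ge>K x. \<not> \<bar>Zs w k - real k\<bar> \<le> real k powr (7/8)}"
    let ?B2 = "{w. \<exists>k\<in>{L..K x}. 0 \<le> Zs w k \<and> Zs w k < real k / sqrt x}"
    let ?B3 = "{w. 0 \<le> Zs w (r + 2) \<and> Zs w (r + 2) < 16 * real L / x}"
    have sets[measurable]: "?B1 \<in> sets Sexp" "?B2 \<in> sets Sexp" "?B3 \<in> sets Sexp"
      by (intro Collect_in_Sexp; measurable)+
    have p1: "Se.prob ?B1 \<le> C / x ^ (r + 2)"
    proof -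
      have "Se.prob ?B1 \<le> C * real (K x) powr (-1/4)" by (rule C(2)[OF K0])
      also have "real (K x) powr (-1/4) = real (nat \<lceil>x\<rceil>) powr (- real (r + 2))"
      proof -
        have "real (K x) = real (nat \<lceil>x\<rceil>) powr real (4 * r + 8)"
          unfolding K_def using n1 x1 by (subst powr_realpow) auto
        then show ?thesis by (simp add: powr_powr algebra_simps)
      qed
      also have "\<dots> \<le> x powr (- real (r + 2))" using n1(1) x1 by (intro powr_mono2') (simp_all del: of_nat_nat)
      also have "\<dots> = 1 / x ^ (r + 2)" using x1 by (simp only: powr_minus powr_realpow) (simp add: field_simps)
      finally show ?thesis using C(1) by (simp add: mult_left_mono)
    qed
    have p2: "Se.prob ?B2 \<le> 2 * exp 1 ^ L / x ^ (r + 2)"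
    proof -
      have "L = 2 * (r + 2)" by (simp add: L_def)
      then have "sqrt x ^ L = sqrt x ^ (2 * (r + 2))" by (rule arg_cong)
      also have "\<dots> = (sqrt x ^ 2) ^ (r + 2)" by (rule power_mult)
      also have "sqrt x ^ 2 = x" using x1 by simp
      finally have "sqrt x ^ L = x ^ (r + 2)" .
      then show ?thesis using prob_small_Zs[of x L "K x"] elim by (simp add: power_divide)
    qed
    have p3: "Se.prob ?B3 \<le> (16 * real L) ^ (r + 2) / x ^ (r + 2)"
    proof -
      have "Se.prob ?B3 \<le> (16 * real L / x) ^ (r + 2) / fact (r + 2)"
        using x1 by (intro prob_Zs_less_nonneg) auto
      also have "\<dots> \<le> (16 * real L / x) ^ (r + 2) / 1"
        using x1 by (intro divide_left_mono) (auto simp: fact_ge_1 simp del: fact_Suc)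
      finally show ?thesis by (simp add: power_divide)
    qed
    have "Se.prob {w. x < Yf \<gamma> r w \<and> step_fun \<gamma> (Zs w (Suc r)) \<le> x / 2} \<le> Se.prob (?B1 \<union> (?B2 \<union> ?B3))"
    proof (rule Se.finite_measure_mono_AE)
      show "AE w in Sexp. w \<in> {w. x < Yf \<gamma> r w \<and> step_fun \<gamma> (Zs w (Suc r)) \<le> x / 2} \<longrightarrow> w \<in> ?B1 \<union> (?B2 \<union> ?B3)"
        using AE_regular_path
      proof eventually_elim
        fix w assume w: "regular_path w"
        have pos: "0 < Zs w k" if "k > 0" for k using w that by (intro Zs_pos) (auto simp: regular_path_def)
        show "w \<in> {w. x < Yf \<gamma> r w \<and> step_fun \<gamma> (Zs w (Suc r)) \<le> x / 2} \<longrightarrow> w \<in> ?B1 \<union> (?B2 \<union> ?B3)"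
        proof (rule impI, rule ccontr)
          assume Y: "w \<in> {w. x < Yf \<gamma> r w \<and> step_fun \<gamma> (Zs w (Suc r)) \<le> x / 2}" and nB: "w \<notin> ?B1 \<union> (?B2 \<union> ?B3)"
          have "Yf \<gamma> r w \<le> step_fun \<gamma> (Zs w (Suc r)) + (\<Sum>k\<in>{Suc (Suc r)..K x}. 2 / Zs w k) + (\<Sum>j. osc \<gamma> (j + Suc (K x)))"
            using nB m0 Km by (intro Yf_le g w) auto
          also have "\<dots> \<le> x / 2 + (\<Sum>k\<in>{Suc (Suc r)..K x}. 2 / Zs w k) + 1"
            using Y m0[of "Suc (K x)"] Km by auto
          also have "(\<Sum>k\<in>{Suc (Suc r)..K x}. 2 / Zs w k) \<le> (\<Sum>k\<in>{Suc (Suc r)..<L} \<union> {L..K x}. 2 / Zs w k)"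
          proof (intro sum_mono2)
            fix k assume "k \<in> {Suc (Suc r)..<L} \<union> {L..K x} - {Suc (Suc r)..K x}"
            then have "0 < Zs w k" by (intro pos) (auto simp: L_def)
            then show "0 \<le> 2 / Zs w k" by simp
          qed auto
          also have "\<dots> = (\<Sum>k\<in>{Suc (Suc r)..<L}. 2 / Zs w k) + (\<Sum>k\<in>{L..K x}. 2 / Zs w k)"
            by (intro sum.union_disjoint) auto
          also have "(\<Sum>k\<in>{Suc (Suc r)..<L}. 2 / Zs w k) \<le> x / 8"
          proof -
            have "2 / Zs w k \<le> x / (8 * real L)" if "k \<in> {Suc (Suc r)..<L}" for k
            proof -
              have "16 * real L / x \<le> Zs w (r + 2)" using nB pos[of "r + 2"] by auto
              also have "\<dots> \<le> Zs w k" using w that by (intro Zs_mono) (auto simp: regular_path_def)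
              finally have "16 * real L / x \<le> Zs w k" .
              then show ?thesis using pos[of k] that x1 by (simp add: field_simps)
            qed
            then have "(\<Sum>k\<in>{Suc (Suc r)..<L}. 2 / Zs w k) \<le> real (card {Suc (Suc r)..<L}) * (x / (8 * real L))"
              by (intro sum_bounded_above) auto
            also have "\<dots> \<le> real L * (x / (8 * real L))"
              using x1 by (intro mult_right_mono) auto
            also have "\<dots> = x / 8"
            proof -
              have "0 < L" by (simp add: L_def)
              then show ?thesis by simp
            qed
            finally show ?thesis .
          qed
          also have "(\<Sum>k\<in>{L..K x}. 2 / Zs w k) \<le> 2 * sqrt x * (1 + real (4 * r + 8) * ln (x + 1))"
          proof -
            have "(\<Sum>k\<in>{L..K x}. 2 / Zs w k) \<le> (\<Sum>k\<in>{L..K x}. 2 * sqrt x * (1 / real k))"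
            proof (intro sum_mono)
              fix k assume k: "k \<in> {L..K x}"
              then have k0: "k > 0" by (auto simp: L_def)
              have "real k / sqrt x \<le> Zs w k"
              proof -
                have "w \<notin> ?B2" using nB by blast
                then have "\<not> (0 \<le> Zs w k \<and> Zs w k < real k / sqrt x)" using k by blast
                then show ?thesis using pos[OF k0] by linarith
              qed
              then show "2 / Zs w k \<le> 2 * sqrt x * (1 / real k)"
                using k0 pos[OF k0] x1 by (simp add: field_simps)
            qed
            also have "\<dots> \<le> (\<Sum>k\<in>{1..K x}. 2 * sqrt x * (1 / real k))"
              using x1 by (intro sum_mono2) (auto simp: L_def)
            also have "\<dots> = 2 * sqrt x * harm (K x)"
              by (simp add: harm_def sum_distrib_left divide_inverse)
            also have "\<dots> \<le> 2 * sqrt x * (1 + real (4 * r + 8) * ln (x + 1))"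
            proof (intro mult_left_mono)
              \<comment> \<open>\<open>harm n - ln n\<close> decreases from its value 1 at
                \<open>n = 1\<close>.\<close>
              have "harm (K x) \<le> 1 + ln (real (K x))"
                using decseqD[OF decseq_harm_diff_ln, of 0 "K x - 1"] K0 by (simp add: harm_expand)
              also have "ln (real (K x)) = real (4 * r + 8) * ln (real (nat \<lceil>x\<rceil>))"
                unfolding K_def using n1 x1 by (simp add: ln_realpow)
              also have "\<dots> \<le> real (4 * r + 8) * ln (x + 1)"
                using n1 x1 by (intro mult_left_mono) auto
              finally show "harm (K x) \<le> 1 + real (4 * r + 8) * ln (x + 1)" by simp
            qed (use x1 in auto)
            finally show ?thesis .
          qed
          finally have "Yf \<gamma> r w \<le> x / 2 + (x / 8 + 2 * sqrt x * (1 + real (4 * r + 8) * ln (x + 1))) + 1" by simp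
          moreover have "2 * sqrt x * (1 + real (4 * r + 8) * ln (x + 1)) + 1 < 3 / 8 * x"
          proof -
            have "2 * sqrt x * (1 + real (4 * r + 8) * ln (x + 1)) + 1
              = x * ((2 * sqrt x + 1) / x + 2 * real (4 * r + 8) * (sqrt x * ln (x + 1) / x))"
              using x1 by (simp add: field_simps)
            also have "\<dots> < x * (3 / 8)" using x1 by (intro mult_strict_left_mono elim(1)) auto
            finally show ?thesis by simp
          qed
          ultimately show False using Y by simp
        qed
      qed
    qed measurable
    also have "\<dots> \<le> Se.prob ?B1 + Se.prob (?B2 \<union> ?B3)"
      by (intro measure_Un_le) measurable
    also have "Se.prob (?B2 \<union> ?B3) \<le> Se.prob ?B2 + Se.prob ?B3"
      by (intro measure_Un_le) measurable
    finally show ?case using p1 p2 p3 unfolding D_def by (simp add: add_divide_distrib)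
  qed
  show ?thesis
  proof (rule tendsto_sandwich[of "\<lambda>_. 0" _ _ "\<lambda>x. D / x"])
    show "eventually (\<lambda>x. x ^ Suc r * Se.prob {w. x < Yf \<gamma> r w \<and> step_fun \<gamma> (Zs w (Suc r)) \<le> x / 2} \<le> D / x) at_top"
      using ev eventually_gt_at_top[of 0]
    proof eventually_elim
      case (elim x)
      have "x ^ Suc r * Se.prob {w. x < Yf \<gamma> r w \<and> step_fun \<gamma> (Zs w (Suc r)) \<le> x / 2} \<le> x ^ Suc r * (D / x ^ (r + 2))"
        using elim by (intro mult_left_mono) auto
      also have "\<dots> = D / x" using elim by (simp add: field_simps)
      finally show ?case .
    qed
    show "eventually (\<lambda>x. 0 \<le> x ^ Suc r * Se.prob {w. x < Yf \<gamma> r w \<and> step_fun \<gamma> (Zs w (Suc r)) \<le> x / 2}) at_top"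
      using eventually_gt_at_top[of 0] by eventually_elim auto
    show "((\<lambda>x. D / x) \<longlongrightarrow> 0) at_top"
      by (intro tendsto_divide_0[OF tendsto_const] filterlim_at_top_imp_at_infinity filterlim_ident)
  qed auto
qed

subsection \<open>Absence of atoms\<close>

lemma nn_integral_exp_Icc:
  assumes "a \<le> b"
  shows "(\<integral>\<^sup>+v. ennreal (exp (-v)) * indicator {a..b} v \<partial>lborel) = ennreal (exp (-a) - exp (-b))"
proof -
  have "(\<integral>\<^sup>+v. ennreal (exp (-v)) * indicator {a..b} v \<partial>lborel) = ennreal ((- exp (-b)) - (- exp (-a)))"
    by (rule nn_integral_FTC_Icc) (use assms in \<open>auto intro!: derivative_eq_intros\<close>)
  then show ?thesis by simp
qed

lemma nn_integral_exp_atLeast: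
  "(\<integral>\<^sup>+v. ennreal (exp (-v)) * indicator {a..} v \<partial>lborel) = ennreal (exp (-a))"
proof -
  have "(\<integral>\<^sup>+v. ennreal (exp (-v)) * indicator {a..} v \<partial>lborel) = ennreal (0 - (- exp (-a)))"
  proof (rule nn_integral_FTC_atLeast)
    show "((\<lambda>x. - exp (- x)) \<longlongrightarrow> 0) (at_top :: real filter)" by real_asymp
  qed (auto intro!: derivative_eq_intros)
  then show ?thesis by simp
qed

text \<open>
  Here \<open>q u\<close> stands for the probability that a rate one renewal process started at \<open>u\<close> avoids \<open>U\<close>.
  The equation makes \<open>q u \<le> q c\<close> for \<open>u \<le> c\<close>, and starting at the left end of an interval of length
  \<open>\<delta>\<close> inside \<open>U\<close> costs a factor \<open>e\<^bsup>-\<delta>\<^esup>\<close>; hence \<open>sup q \<le> e\<^bsup>-\<delta>\<^esup> sup q\<close>.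
\<close>

lemma renewal_avoidance_zero:
  fixes q :: "real \<Rightarrow> real"
  assumes [measurable]: "q \<in> borel_measurable borel" "U \<in> sets borel"
    and q01: "\<And>u. 0 \<le> q u" "\<And>u. q u \<le> 1"
    and ren: "\<And>u. 0 \<le> u \<Longrightarrow> ennreal (exp (-u) * q u) = (\<integral>\<^sup>+v. ennreal (exp (-v) * q v) * indicator ({u..} - U) v \<partial>lborel)"
    and d: "0 < \<delta>" and hit: "\<And>u. \<exists>c\<ge>u. {c..<c+\<delta>} \<subseteq> U"
    and u: "0 \<le> u"
  shows "q u = 0"
proof -
  define Q where "Q = (SUP u\<in>{0..}. q u)"
  have bdd: "bdd_above (q ` A)" for A using q01 by (intro bdd_aboveI2[of _ _ 1]) auto
  have qQ: "q u \<le> Q" if "0 \<le> u" for u unfolding Q_def using that by (intro cSUP_upper bdd) auto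
  have Q0: "0 \<le> Q" using qQ[of 0] q01(1)[of 0] by linarith
  have step1: "q c \<le> exp (-\<delta>) * Q" if c: "0 \<le> c" "{c..<c+\<delta>} \<subseteq> U" for c
  proof -
    have "ennreal (exp (-c) * q c) = (\<integral>\<^sup>+v. ennreal (exp (-v) * q v) * indicator ({c..} - U) v \<partial>lborel)"
      by (rule ren) (rule c)
    also have "\<dots> \<le> (\<integral>\<^sup>+v. ennreal Q * (ennreal (exp (-v)) * indicator {c+\<delta>..} v) \<partial>lborel)"
    proof (intro nn_integral_mono)
      fix v
      have "v \<in> {c+\<delta>..}" if "v \<in> {c..} - U" using that c by force
      then show "ennreal (exp (-v) * q v) * indicator ({c..} - U) v \<le> ennreal Q * (ennreal (exp (-v)) * indicator {c+\<delta>..} v)"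
        using qQ[of v] c(1) Q0 by (auto simp: indicator_def ennreal_mult'[symmetric] mult.commute intro!: ennreal_leI mult_left_mono)
    qed
    also have "\<dots> = ennreal Q * ennreal (exp (-(c+\<delta>)))"
      by (subst nn_integral_cmult) (auto simp: nn_integral_exp_atLeast)
    also have "\<dots> = ennreal (Q * exp (-(c+\<delta>)))" using Q0 by (simp add: ennreal_mult')
    finally have "exp (-c) * q c \<le> Q * exp (-(c+\<delta>))" using Q0 by (simp add: ennreal_le_iff)
    also have "Q * exp (-(c+\<delta>)) = exp (-c) * (exp (-\<delta>) * Q)"
    proof -
      have "- (c + \<delta>) = - c + - \<delta>" by simp
      then show ?thesis by (simp only: exp_add) (simp add: mult_ac)
    qed
    finally show ?thesis by simp
  qed
  have step2: "q u \<le> q c" if uc: "0 \<le> u" "u \<le> c" for u c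
  proof -
    define S where "S = (SUP u\<in>{0..c}. q u)"
    have qS: "q u \<le> S" if "0 \<le> u" "u \<le> c" for u unfolding S_def using that by (intro cSUP_upper bdd) auto
    have S0: "0 \<le> S" using qS[OF uc] q01(1)[of u] by linarith
    \<comment> \<open>The integral is split at \<open>c\<close>: below \<open>c\<close> the function
      is at most \<open>S\<close>, and the part above \<open>c\<close> is the renewal equation at
      \<open>c\<close>.\<close>
    have main: "exp (-u) * q u \<le> S * (exp (-u) - exp (-c)) + exp (-c) * q c" if uc: "0 \<le> u" "u \<le> c" for u
    proof -
      have "ennreal (exp (-u) * q u) = (\<integral>\<^sup>+v. ennreal (exp (-v) * q v) * indicator ({u..} - U) v \<partial>lborel)"
        by (rule ren) (rule uc)
      also have "\<dots> \<le> (\<integral>\<^sup>+v. ennreal S * (ennreal (exp (-v)) * indicator {u..c} v) + ennreal (exp (-v) * q v) * indicator ({c..} - U) v \<partial>lborel)"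
      proof (intro nn_integral_mono)
        fix v
        show "ennreal (exp (-v) * q v) * indicator ({u..} - U) v \<le>
           ennreal S * (ennreal (exp (-v)) * indicator {u..c} v) + ennreal (exp (-v) * q v) * indicator ({c..} - U) v"
        proof (cases "v \<in> {u..} - U \<and> v < c")
          case True
          then have "ennreal (exp (-v) * q v) \<le> ennreal S * ennreal (exp (-v))"
            using qS[of v] uc S0 by (auto simp: ennreal_mult'[symmetric] mult.commute intro!: ennreal_leI mult_left_mono)
          then show ?thesis using True by (simp add: indicator_def add_increasing2)
        next
          case False
          then show ?thesis by (auto simp: indicator_def)
        qed
      qed
      also have "\<dots> = (\<integral>\<^sup>+v. ennreal S * (ennreal (exp (-v)) * indicator {u..c} v) \<partial>lborel) + (\<integral>\<^sup>+v. ennreal (exp (-v) * q v) * indicator ({c..} - U) v \<partial>lborel)"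
        by (rule nn_integral_add) auto
      also have "\<dots> = ennreal S * ennreal (exp (-u) - exp (-c)) + ennreal (exp (-c) * q c)"
        using uc ren[of c] by (subst nn_integral_cmult) (auto simp: nn_integral_exp_Icc)
      also have "\<dots> = ennreal (S * (exp (-u) - exp (-c)) + exp (-c) * q c)"
        using S0 uc q01 by (simp add: ennreal_mult' ennreal_plus)
      finally show ?thesis using S0 uc q01 by (subst (asm) ennreal_le_iff) auto
    qed
    \<comment> \<open>\<open>main\<close> bounds \<open>q u\<close> by an average of
      \<open>S\<close> and \<open>q c\<close> in which \<open>q c\<close> has weight at least
      \<open>exp (-c)\<close>; if \<open>S\<close> exceeded \<open>q c\<close>, the supremum would
      be strictly smaller than itself.\<close>
    have "S \<le> q c"
    proof (rule ccontr)
      assume "\<not> S \<le> q c"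
      then have Sc: "S - q c > 0" by simp
      have "(SUP u\<in>{0..c}. q u) \<le> S - exp (-c) * (S - q c)"
      proof (rule cSUP_least)
        fix u assume "u \<in> {0..c}"
        then have uc: "0 \<le> u" "u \<le> c" by auto
        have "exp (-u) * q u \<le> exp (-u) * (S - exp (u - c) * (S - q c))"
          using main[OF uc] by (simp add: algebra_simps mult_exp_exp)
        then have "q u \<le> S - exp (u - c) * (S - q c)" by simp
        also have "\<dots> \<le> S - exp (-c) * (S - q c)"
          using Sc uc by (intro diff_left_mono mult_right_mono) auto
        finally show "q u \<le> S - exp (-c) * (S - q c)" .
      qed (use uc in auto)
      then have "S \<le> S - exp (-c) * (S - q c)" by (simp only: S_def)
      then have "exp (-c) * (S - q c) \<le> 0" by simp
      with Sc show False by (simp add: mult_le_0_iff)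
    qed
    with qS[OF uc] show ?thesis by linarith
  qed
  have "q u \<le> exp (-\<delta>) * Q" if "0 \<le> u" for u
  proof -
    obtain c where "c \<ge> u" "{c..<c+\<delta>} \<subseteq> U" using hit by blast
    then show ?thesis using step1[of c] step2[of u c] that by linarith
  qed
  then have "Q \<le> exp (-\<delta>) * Q" unfolding Q_def[symmetric]
    by (subst Q_def) (rule cSUP_least, auto)
  moreover have "exp (-\<delta>) < 1" using d by simp
  ultimately have "Q \<le> 0" using Q0 mult_less_cancel_right2[of "exp (-\<delta>)" Q] by (smt (verit))
  then show ?thesis using qQ[OF u] q01(1)[of u] by linarith
qed

lemma Zs_case_nat: "Zs (case_nat x w) (Suc j) = x + Zs w j"
  unfolding Zs_def by (subst sum.lessThan_Suc_shift) simp

lemma distr_case_nat: "distr (Exp1 \<Otimes>\<^sub>M Sexp) Sexp (\<lambda>(x, w). case_nat x w) = Sexp"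
  unfolding Sexp_def by (rule SS.PiM_iter)

lemma case_nat_measurable[measurable]: "(\<lambda>(x, w). case_nat x w) \<in> measurable (Exp1 \<Otimes>\<^sub>M Sexp) Sexp"
  unfolding Sexp_def by measurable

interpretation ES: pair_sigma_finite Exp1 Sexp
  by unfold_locales

text \<open>Prepending an independent exponential variable preserves the law of the sequence; this
  allows conditioning on the first variable.\<close>

lemma emeasure_Sexp_case_nat:
  assumes A: "A \<in> sets Sexp"
  shows "emeasure Sexp A = emeasure (Exp1 \<Otimes>\<^sub>M Sexp) {(x, w). case_nat x w \<in> A}"
    and "{(x, w). case_nat x w \<in> A} \<in> sets (Exp1 \<Otimes>\<^sub>M Sexp)"
proof -
  have eq: "(\<lambda>(x, w). case_nat x w) -` A \<inter> space (Exp1 \<Otimes>\<^sub>M Sexp) = {(x, w). case_nat x w \<in> A}"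
    by (auto simp: space_pair_measure)
  show "{(x, w). case_nat x w \<in> A} \<in> sets (Exp1 \<Otimes>\<^sub>M Sexp)"
    using measurable_sets[OF case_nat_measurable A] by (simp only: eq)
  show "emeasure Sexp A = emeasure (Exp1 \<Otimes>\<^sub>M Sexp) {(x, w). case_nat x w \<in> A}"
    by (subst distr_case_nat[symmetric]) (simp add: emeasure_distr A eq)
qed

text \<open>An application of \<open>renewal_avoidance_zero\<close> to the union \<open>U\<close> of
  these intervals; they all have length \<open>t - s\<close> and occur arbitrarily far to the right.
  Only the start \<open>u = 0\<close> is wanted, but the renewal equation relates all starting
  points.\<close>

lemma AE_hit:
  assumes g: "\<gamma> > 0" and st: "s < t"
  shows "AE w in Sexp. \<exists>j m::nat. \<gamma> * 2 ^ m - t \<le> Zs w (Suc j) \<and> Zs w (Suc j) < \<gamma> * 2 ^ m - s"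
proof -
  define U where "U = (\<Union>m::nat. {\<gamma> * 2 ^ m - t ..< \<gamma> * 2 ^ m - s})"
  have U[measurable]: "U \<in> sets borel" unfolding U_def by auto
  define A where "A u = {w. \<forall>j. u + Zs w (Suc j) \<notin> U}" for u
  have A_sets[measurable]: "A u \<in> sets Sexp" for u
    unfolding A_def by (intro Collect_in_Sexp) measurable
  define q where "q u = Se.prob (A u)" for u
  have "q 0 = 0"
  proof (rule renewal_avoidance_zero[where q = q and \<delta> = "t - s" and U = U])
    have "(\<lambda>u. emeasure Sexp (Pair u -` {x. \<forall>j. fst x + Zs (snd x) (Suc j) \<notin> U})) \<in> borel_measurable borel"
    proof (rule Se.measurable_emeasure_Pair)
      have "{x \<in> space (borel \<Otimes>\<^sub>M Sexp). \<forall>j. fst x + Zs (snd x) (Suc j) \<notin> U} \<in> sets (borel \<Otimes>\<^sub>M Sexp)"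
        by measurable
      then show "{x. \<forall>j. fst x + Zs (snd x) (Suc j) \<notin> U} \<in> sets (borel \<Otimes>\<^sub>M Sexp)"
        by (simp add: space_pair_measure)
    qed
    then have e[measurable]: "(\<lambda>u. emeasure Sexp (A u)) \<in> borel_measurable borel"
      by (simp add: A_def vimage_def)
    show "q \<in> borel_measurable borel"
      unfolding q_def measure_def by measurable
    show "ennreal (exp (-u) * q u) = (\<integral>\<^sup>+v. ennreal (exp (-v) * q v) * indicator ({u..} - U) v \<partial>lborel)" for u
    proof -
      define f where "f v = ennreal (exponential_density 1 (v - u)) * (emeasure Sexp (A v) * indicator (-U) v)" for v
      have f[measurable]: "f \<in> borel_measurable borel" unfolding f_def by measurable
      have "ennreal (q u) = emeasure Sexp (A u)" by (simp add: q_def Se.emeasure_eq_measure)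
      also have "\<dots> = emeasure (Exp1 \<Otimes>\<^sub>M Sexp) {(x, w). case_nat x w \<in> A u}"
        by (rule emeasure_Sexp_case_nat) measurable
      also have "\<dots> = (\<integral>\<^sup>+x. emeasure Sexp (Pair x -` {(x, w). case_nat x w \<in> A u}) \<partial>Exp1)"
        by (intro Se.emeasure_pair_measure_alt emeasure_Sexp_case_nat) measurable
      \<comment> \<open>The first jump leads to \<open>u + x\<close>: this point must avoid
        \<open>U\<close>, and from there the avoidance problem starts afresh.\<close>
      also have "\<dots> = (\<integral>\<^sup>+x. emeasure Sexp (A (u + x)) * indicator (-U) (u + x) \<partial>Exp1)"
      proof (intro nn_integral_cong)
        fix x
        have "Pair x -` {(x, w). case_nat x w \<in> A u} = (if u + x \<in> U then {} else A (u + x))"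
        proof -
          have "(\<forall>j. u + (x + Zs w j) \<notin> U) \<longleftrightarrow> u + x \<notin> U \<and> (\<forall>j. (u + x) + Zs w (Suc j) \<notin> U)" for w
          proof -
            have all_Suc: "(\<forall>j. P j) \<longleftrightarrow> P 0 \<and> (\<forall>j. P (Suc j))" for P :: "nat \<Rightarrow> bool"
              by (metis not0_implies_Suc)
            show ?thesis
              by (subst all_Suc) (simp add: Zs_def algebra_simps)
          qed
          then show ?thesis by (auto simp: A_def Zs_case_nat)
        qed
        then show "emeasure Sexp (Pair x -` {(x, w). case_nat x w \<in> A u}) = emeasure Sexp (A (u + x)) * indicator (-U) (u + x)"
          by simp
      qed
      also have "\<dots> = (\<integral>\<^sup>+x. ennreal (exponential_density 1 x) * (emeasure Sexp (A (u + x)) * indicator (-U) (u + x)) \<partial>lborel)"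
        unfolding Exp1_def by (subst nn_integral_density) auto
      also have "\<dots> = (\<integral>\<^sup>+v. ennreal (exponential_density 1 (v - u)) * (emeasure Sexp (A v) * indicator (-U) v) \<partial>lborel)"
      proof -
        have "(\<integral>\<^sup>+v. f v \<partial>lborel) = ennreal \<bar>1\<bar> * (\<integral>\<^sup>+x. f (u + 1 * x) \<partial>lborel)"
          by (rule nn_integral_real_affine) auto
        then show ?thesis by (simp add: f_def)
      qed
      finally have "ennreal (exp (-u)) * ennreal (q u) = ennreal (exp (-u)) * (\<integral>\<^sup>+v. ennreal (exponential_density 1 (v - u)) * (emeasure Sexp (A v) * indicator (-U) v) \<partial>lborel)"
        by simp
      also have "\<dots> = (\<integral>\<^sup>+v. ennreal (exp (-u)) * (ennreal (exponential_density 1 (v - u)) * (emeasure Sexp (A v) * indicator (-U) v)) \<partial>lborel)"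
        using f unfolding f_def by (intro nn_integral_cmult[symmetric]) simp
      also have "\<dots> = (\<integral>\<^sup>+v. ennreal (exp (-v) * q v) * indicator ({u..} - U) v \<partial>lborel)"
      proof (intro nn_integral_cong)
        fix v
        have "exp (-u) * (exponential_density 1 (v - u) * q v) = exp (-v) * q v" if "u \<le> v"
          using that by (simp add: exponential_density_def mult.assoc[symmetric] mult_exp_exp)
        then show "ennreal (exp (-u)) * (ennreal (exponential_density 1 (v - u)) * (emeasure Sexp (A v) * indicator (-U) v)) = ennreal (exp (-v) * q v) * indicator ({u..} - U) v"
          by (cases "u \<le> v") (auto simp: q_def Se.emeasure_eq_measure indicator_def ennreal_mult'[symmetric] exponential_density_def)
      qed
      finally show ?thesis by (simp add: ennreal_mult')
    qed
    show "\<exists>c\<ge>u. {c..<c + (t - s)} \<subseteq> U" for u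
    proof -
      obtain m where "(u + t) / \<gamma> < 2 ^ m" using real_arch_pow[of 2 "(u + t) / \<gamma>"] by auto
      then have "u \<le> \<gamma> * 2 ^ m - t" using g by (simp add: field_simps)
      then show ?thesis by (intro exI[of _ "\<gamma> * 2 ^ m - t"]) (auto simp: U_def)
    qed
  qed (use st in \<open>auto simp: q_def U\<close>)
  then have "AE w in Sexp. w \<notin> A 0"
    unfolding q_def by (intro AE_not_in) (auto simp: null_sets_def Se.emeasure_eq_measure)
  then show ?thesis
    by eventually_elim (auto simp: A_def U_def)
qed

text \<open>The null set in \<open>AE_hit\<close> depends on the two shifts. Rational pairs leave
  countably many null sets, and rationals \<open>a < b\<close> between \<open>s\<close> and
  \<open>t\<close> give the general case by monotonicity.\<close>

lemma AE_Vf_strict: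
  assumes g: "\<gamma> > 0"
  shows "AE w in Sexp. \<forall>s t. 0 \<le> s \<longrightarrow> s < t \<longrightarrow> Vf \<gamma> t w < Vf \<gamma> s w"
proof -
  have "AE w in Sexp. \<forall>a\<in>\<rat>. \<forall>b\<in>\<rat>. a < b \<longrightarrow> (\<exists>j m::nat. \<gamma> * 2 ^ m - b \<le> Zs w (Suc j) \<and> Zs w (Suc j) < \<gamma> * 2 ^ m - a)"
    using countable_rat by (intro AE_ball_countable' AE_impI AE_hit g)
  with AE_regular_path show ?thesis
  proof eventually_elim
    case (elim w)
    show ?case
    proof (intro allI impI)
      fix s t :: real assume st: "0 \<le> s" "s < t"
      obtain a where a: "a \<in> \<rat>" "s < a" "a < t" using Rats_dense_in_real[OF st(2)] by blast
      obtain b where b: "b \<in> \<rat>" "a < b" "b < t" using Rats_dense_in_real[OF a(3)] by blast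
      obtain j and m :: nat where jm: "\<gamma> * 2 ^ m - b \<le> Zs w (Suc j)" "Zs w (Suc j) < \<gamma> * 2 ^ m - a"
        using elim a b by blast
      have "Vf \<gamma> t w \<le> Vf \<gamma> b w" using st a b by (intro Vf_antimono g elim) auto
      also have "\<dots> < Vf \<gamma> a w"
        using st a b jm by (intro Vf_strict_antimono[of _ _ _ _ j "int m"] g elim) (auto simp: powr_realpow)
      also have "\<dots> \<le> Vf \<gamma> s w" using st a b by (intro Vf_antimono g elim) auto
      finally show "Vf \<gamma> t w < Vf \<gamma> s w" .
    qed
  qed
qed

lemma Vf_measurable[measurable]: "(\<lambda>w. Vf \<gamma> t w) \<in> borel_measurable Sexp"
  unfolding Vf_def by measurable

lemma Yf_measurable[measurable]: "(\<lambda>w. Yf \<gamma> r w) \<in> borel_measurable Sexp"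
  unfolding Yf_def by measurable

text \<open>With the later variables fixed, the case \<open>r = 0\<close> of
  \<open>Yf_comb_seq\<close> shows that \<open>Vf \<gamma> 0\<close> is strictly decreasing in the
  first variable. It takes the value \<open>y\<close> at most once, and \<open>Exp1\<close> has no
  atoms.\<close>

lemma prob_Vf_eq:
  assumes g: "\<gamma> > 0"
  shows "Se.prob {w. Vf \<gamma> 0 w = y} = 0"
proof -
  let ?A = "{w. Vf \<gamma> 0 w = y}"
  have A: "?A \<in> sets Sexp" by (intro Collect_in_Sexp) measurable
  have "emeasure Sexp ?A = emeasure (Exp1 \<Otimes>\<^sub>M Sexp) {(x, w). case_nat x w \<in> ?A}"
    by (rule emeasure_Sexp_case_nat[OF A])
  also have "\<dots> = (\<integral>\<^sup>+w. emeasure Exp1 ((\<lambda>x. (x, w)) -` {(x, w). case_nat x w \<in> ?A}) \<partial>Sexp)"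
    by (rule ES.emeasure_pair_measure_alt2[OF emeasure_Sexp_case_nat(2)[OF A]])
  also have "\<dots> = (\<integral>\<^sup>+w. 0 \<partial>Sexp)"
  proof (rule nn_integral_cong_AE)
    show "AE w in Sexp. emeasure Exp1 ((\<lambda>x. (x, w)) -` {(x, w). case_nat x w \<in> ?A}) = 0"
      using AE_regular_path AE_Vf_strict[OF g]
    proof eventually_elim
      case (elim w)
      define h where "h x = step_fun \<gamma> x + Vf \<gamma> x w" for x
      have eq: "Vf \<gamma> 0 (case_nat x w) = h x" if "0 < x" for x
        using Yf_comb_seq[OF g elim(1), of "\<lambda>_. x" 0] that by (simp add: Yf_0 Arg_sum_def Zs_def h_def)
      have strict: "h x' < h x" if "0 < x" "x < x'" for x x'
        using step_fun_antimono[OF g, of x x'] elim(2) that unfolding h_def by (intro add_le_less_mono) auto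
      obtain z where z: "{x. 0 < x \<and> h x = y} \<subseteq> {z}"
      proof (cases "{x. 0 < x \<and> h x = y} = {}")
        case False
        then obtain z where z: "0 < z" "h z = y" by auto
        have "x = z" if "0 < x" "h x = y" for x
          using strict[of x z] strict[of z x] that z by (cases x z rule: linorder_cases) auto
        then show ?thesis by (intro that[of z]) auto
      qed (auto intro: that)
      have "emeasure Exp1 ((\<lambda>x. (x, w)) -` {(x, w). case_nat x w \<in> ?A}) \<le> emeasure Exp1 ({..0} \<union> {z})"
        using z eq by (intro emeasure_mono) (auto simp: not_le)
      also have "\<dots> = 0"
      proof -
        have "emeasure Exp1 ({..0} \<union> {z}) = (\<integral>\<^sup>+x. ennreal (exponential_density 1 x) * indicator ({..0} \<union> {z}) x \<partial>lborel)"
          unfolding Exp1_def by (rule emeasure_density) auto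
        also have "\<dots> = (\<integral>\<^sup>+x. 0 \<partial>(lborel :: real measure))"
        proof (rule nn_integral_cong_AE)
          show "AE x in lborel. ennreal (exponential_density 1 x) * indicator ({..0} \<union> {z}) x = (0::ennreal)"
            using AE_lborel_singleton[of z] AE_lborel_singleton[of "0::real"]
            by eventually_elim (auto simp: exponential_density_def indicator_def)
        qed
        finally show ?thesis by simp
      qed
      finally show ?case by simp
    qed
  qed
  finally show ?thesis by (simp add: Se.emeasure_eq_measure)
qed

subsection \<open>Uniform comparison of shifted tails\<close>

text \<open>A continuous distribution function is uniformly continuous on the line: compactness
  handles the middle, the limits handle the two tails.\<close>

lemma prob_Vf_interval_small:
  assumes g: "\<gamma> > 0" and e: "\<epsilon> > 0"
  shows "\<exists>\<delta>>0. \<forall>y. Se.prob {w. y < Vf \<gamma> 0 w \<and> Vf \<gamma> 0 w \<le> y + \<delta>} \<le> \<epsilon>"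
proof -
  define \<mu> where "\<mu> = distr Sexp borel (Vf \<gamma> 0)"
  interpret real_distribution \<mu> unfolding \<mu>_def by (rule Se.real_distribution_distr) measurable
  have int: "Se.prob {w. x < Vf \<gamma> 0 w \<and> Vf \<gamma> 0 w \<le> y} = cdf \<mu> y - cdf \<mu> x" if "x < y" for x y
  proof -
    have "cdf \<mu> y - cdf \<mu> x = measure \<mu> {x<..y}" by (rule cdf_diff_eq[OF that])
    also have "\<dots> = Se.prob {w. x < Vf \<gamma> 0 w \<and> Vf \<gamma> 0 w \<le> y}"
      unfolding \<mu>_def by (subst measure_distr) (auto simp: vimage_def)
    finally show ?thesis by simp
  qed
  have cont: "isCont (cdf \<mu>) x" for x
  proof -
    have "measure \<mu> {x} = Se.prob {w. Vf \<gamma> 0 w = x}"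
      unfolding \<mu>_def by (subst measure_distr) (auto simp: vimage_def)
    then show ?thesis by (simp add: isCont_cdf prob_Vf_eq[OF g])
  qed
  obtain L1 where L1: "\<And>x. x \<ge> L1 \<Longrightarrow> 1 - \<epsilon> < cdf \<mu> x"
    using order_tendstoD(1)[OF cdf_lim_at_top_prob, of "1 - \<epsilon>"] e by (auto simp: eventually_at_top_linorder)
  obtain L2 where L2: "\<And>x. x \<le> L2 \<Longrightarrow> cdf \<mu> x < \<epsilon>"
    using order_tendstoD(2)[OF cdf_lim_at_bot, of \<epsilon>] e by (auto simp: eventually_at_bot_linorder)
  have "uniformly_continuous_on {L2 - 1..L1 + 1} (cdf \<mu>)"
    by (intro compact_uniformly_continuous continuous_at_imp_continuous_on ballI cont) auto
  then obtain d where d: "d > 0" "\<And>x x'. x \<in> {L2 - 1..L1 + 1} \<Longrightarrow> x' \<in> {L2 - 1..L1 + 1} \<Longrightarrow> dist x' x < d \<Longrightarrow> dist (cdf \<mu> x') (cdf \<mu> x) < \<epsilon>"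
    unfolding uniformly_continuous_on_def using e by metis
  \<comment> \<open>Since \<open>\<delta> <= 1\<close>, the margins of 1 at \<open>L2\<close> and
    \<open>L1\<close> ensure that \<open>y\<close> and \<open>y + \<delta>\<close> both lie in the
    same tail or both in the compact interval.\<close>
  define \<delta> where "\<delta> = min 1 (d / 2)"
  have \<delta>: "0 < \<delta>" "\<delta> \<le> 1" "\<delta> < d" using d(1) by (auto simp: \<delta>_def)
  show ?thesis
  proof (intro exI[of _ \<delta>] conjI allI \<delta>(1))
    fix y
    have "cdf \<mu> (y + \<delta>) - cdf \<mu> y \<le> \<epsilon>"
    proof -
      consider "y < L2 - 1" | "y + \<delta> > L1 + 1" | "y \<in> {L2 - 1..L1 + 1}" "y + \<delta> \<in> {L2 - 1..L1 + 1}"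
        using \<delta> by fastforce
      then show ?thesis
      proof cases
        case 1
        then show ?thesis using L2[of "y + \<delta>"] \<delta> cdf_nonneg[of y] by linarith
      next
        case 2
        then show ?thesis using L1[of y] \<delta> cdf_bounded_prob[of "y + \<delta>"] by linarith
      next
        case 3
        then show ?thesis using d(2)[OF 3] \<delta> by (simp add: dist_real_def)
      qed
    qed
    then show "Se.prob {w. y < Vf \<gamma> 0 w \<and> Vf \<gamma> 0 w \<le> y + \<delta>} \<le> \<epsilon>" using \<delta> int[of y "y + \<delta>"] by simp
  qed
qed

lemma prob_Vf_shift_tendsto_0:
  assumes g: "\<gamma> > 0" and d: "\<delta> > 0"
  shows "(\<lambda>n. Se.prob {w. \<delta> \<le> Vf \<gamma> 0 w - Vf \<gamma> (1 / real (Suc n)) w}) \<longlonglongrightarrow> 0"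
proof -
  let ?A = "\<lambda>n. {w. \<delta> \<le> Vf \<gamma> 0 w - Vf \<gamma> (1 / real (Suc n)) w}"
  have A: "?A n \<in> sets Sexp" for n by (intro Collect_in_Sexp) measurable
  have "(\<lambda>n. Se.expectation (indicator (?A n) :: _ \<Rightarrow> real)) \<longlonglongrightarrow> Se.expectation (\<lambda>_. 0)"
  proof (rule integral_dominated_convergence[where w = "\<lambda>_. 1"])
    show "AE w in Sexp. (\<lambda>n. indicator (?A n) w :: real) \<longlonglongrightarrow> 0"
      using AE_regular_path
    proof eventually_elim
      case (elim w)
      have "filterlim (\<lambda>n. 1 / real (Suc n)) (at_right 0) sequentially" by real_asymp
      from filterlim_compose[OF Vf_right_continuous[OF g elim] this]
      have "eventually (\<lambda>n. Vf \<gamma> 0 w - \<delta> < Vf \<gamma> (1 / real (Suc n)) w) sequentially"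
        using d by (intro order_tendstoD) auto
      then have "eventually (\<lambda>n. indicator (?A n) w = (0::real)) sequentially"
        by eventually_elim (auto simp: indicator_def)
      then show ?case by (rule tendsto_eventually)
    qed
  qed (use A in \<open>auto simp: indicator_def\<close>)
  then show ?thesis using A by simp
qed

text \<open>If \<open>Vf\<close> drops by less than \<open>\<delta>\<close> between the shifts 0 and
  \<open>\<tau>\<close>, then exceeding \<open>y\<close> at 0 but not at \<open>t\<close> forces
  \<open>Vf \<gamma> 0 w\<close> into \<open>(y, y + \<delta>]\<close>. Monotonicity reduces all
  \<open>t\<close> to \<open>\<tau>\<close>; each exceptional event gets half of
  \<open>\<epsilon>\<close>.\<close>

lemma prob_Vf_shift_uniform:
  assumes g: "\<gamma> > 0" and e: "\<epsilon> > 0"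
  shows "\<exists>\<tau>>0. \<forall>t\<in>{0..\<tau>}. \<forall>y. Se.prob {w. y < Vf \<gamma> 0 w} \<le> Se.prob {w. y < Vf \<gamma> t w} + \<epsilon>"
proof -
  obtain \<delta> where \<delta>: "\<delta> > 0" "\<And>y. Se.prob {w. y < Vf \<gamma> 0 w \<and> Vf \<gamma> 0 w \<le> y + \<delta>} \<le> \<epsilon> / 2"
    using prob_Vf_interval_small[OF g, of "\<epsilon> / 2"] e by auto
  have "eventually (\<lambda>n. Se.prob {w. \<delta> \<le> Vf \<gamma> 0 w - Vf \<gamma> (1 / real (Suc n)) w} < \<epsilon> / 2) sequentially"
    using prob_Vf_shift_tendsto_0[OF g \<delta>(1)] by (rule order_tendstoD) (use e in auto)
  then obtain n where n: "Se.prob {w. \<delta> \<le> Vf \<gamma> 0 w - Vf \<gamma> (1 / real (Suc n)) w} < \<epsilon> / 2"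
    by (auto simp: eventually_sequentially)
  define \<tau> where "\<tau> = 1 / real (Suc n)"
  show ?thesis
  proof (intro exI[of _ \<tau>] conjI ballI allI)
    show "\<tau> > 0" by (simp add: \<tau>_def)
    fix t y assume t: "t \<in> {0..\<tau>}"
    let ?A = "{w. y < Vf \<gamma> t w}" and ?B = "{w. y < Vf \<gamma> 0 w \<and> Vf \<gamma> 0 w \<le> y + \<delta>}"
      and ?C = "{w. \<delta> \<le> Vf \<gamma> 0 w - Vf \<gamma> \<tau> w}"
    have [measurable]: "?A \<in> sets Sexp" "?B \<in> sets Sexp" "?C \<in> sets Sexp"
      by (intro Collect_in_Sexp; measurable)+
    have "Se.prob {w. y < Vf \<gamma> 0 w} \<le> Se.prob (?A \<union> (?B \<union> ?C))"
    proof (rule Se.finite_measure_mono_AE)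
      show "AE w in Sexp. w \<in> {w. y < Vf \<gamma> 0 w} \<longrightarrow> w \<in> ?A \<union> (?B \<union> ?C)"
        using AE_regular_path
      proof eventually_elim
        case (elim w)
        have "Vf \<gamma> \<tau> w \<le> Vf \<gamma> t w" using t by (intro Vf_antimono g elim) auto
        then show ?case by auto
      qed
    qed measurable
    also have "\<dots> \<le> Se.prob ?A + Se.prob (?B \<union> ?C)" by (intro measure_Un_le) measurable
    also have "Se.prob (?B \<union> ?C) \<le> Se.prob ?B + Se.prob ?C" by (intro measure_Un_le) measurable
    finally show "Se.prob {w. y < Vf \<gamma> 0 w} \<le> Se.prob {w. y < Vf \<gamma> t w} + \<epsilon>"
      using \<delta>(2)[of y] n by (simp add: \<tau>_def)
  qed
qed

section \<open>Splitting off the first \<open>r + 1\<close> variables\<close>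

interpretation SP: pair_prob_space Sexp Sexp
  by unfold_locales

lemma AE_pair_regular_path: "AE x in Sexp \<Otimes>\<^sub>M Sexp. (\<forall>i. 0 < fst x i) \<and> regular_path (snd x)"
proof -
  have [measurable]: "Measurable.pred Sexp regular_path"
    unfolding regular_path_def eventually_sequentially by measurable
  show ?thesis
  proof (rule SP.AE_pair_measure)
    show "{x \<in> space (Sexp \<Otimes>\<^sub>M Sexp). (\<forall>i. 0 < fst x i) \<and> regular_path (snd x)} \<in> sets (Sexp \<Otimes>\<^sub>M Sexp)"
      by measurable
    show "AE x in Sexp. AE y in Sexp. (\<forall>i. 0 < fst (x, y) i) \<and> regular_path (snd (x, y))"
      using AE_pos by eventually_elim (use AE_regular_path in \<open>eventually_elim, simp\<close>)
  qed
qed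

lemma comb_seq_Sexp[measurable]: "(\<lambda>(w', w). comb_seq n w' w) \<in> measurable (Sexp \<Otimes>\<^sub>M Sexp) Sexp"
  unfolding Sexp_def by measurable

lemma distr_comb_seq: "distr (Sexp \<Otimes>\<^sub>M Sexp) Sexp (\<lambda>(w', w). comb_seq n w' w) = Sexp"
  unfolding Sexp_def by (rule SS.PiM_comb_seq)

text \<open>Splicing two independent paths at \<open>n\<close> preserves the law, so events about
  the first \<open>n\<close> variables and about the later ones can be treated as factors of a
  product.\<close>

lemma prob_comb_seq:
  assumes A: "A \<in> sets Sexp"
  shows "Se.prob A = measure (Sexp \<Otimes>\<^sub>M Sexp) {x. comb_seq n (fst x) (snd x) \<in> A}"
    and "{x. comb_seq n (fst x) (snd x) \<in> A} \<in> sets (Sexp \<Otimes>\<^sub>M Sexp)"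
proof -
  have eq: "(\<lambda>(w', w). comb_seq n w' w) -` A \<inter> space (Sexp \<Otimes>\<^sub>M Sexp) = {x. comb_seq n (fst x) (snd x) \<in> A}"
    by (auto simp: space_pair_measure)
  show "{x. comb_seq n (fst x) (snd x) \<in> A} \<in> sets (Sexp \<Otimes>\<^sub>M Sexp)"
    using measurable_sets[OF comb_seq_Sexp A, of n] by (simp only: eq)
  show "Se.prob A = measure (Sexp \<Otimes>\<^sub>M Sexp) {x. comb_seq n (fst x) (snd x) \<in> A}"
    by (subst distr_comb_seq[of n, symmetric]) (simp add: measure_distr A eq)
qed

lemma measure_Sexp_Times:
  assumes "A \<in> sets Sexp" "B \<in> sets Sexp"
  shows "measure (Sexp \<Otimes>\<^sub>M Sexp) (A \<times> B) = Se.prob A * Se.prob B"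
  using Se.emeasure_pair_measure_Times[OF assms]
  by (simp add: Se.emeasure_eq_measure SP.P.emeasure_eq_measure ennreal_mult'[symmetric])

context
  fixes \<gamma> a b c x :: real and r :: nat
  assumes g: "\<gamma> > 0" and ab: "0 \<le> a" "a \<le> b"
begin

lemma events_block:
  "{w. a \<le> Zs w (Suc r) \<and> Zs w (Suc r) < b} \<in> sets Sexp"
  "{w. (a \<le> Zs w (Suc r) \<and> Zs w (Suc r) < b) \<and> x < Yf \<gamma> r w} \<in> sets Sexp"
  "{w. y < Vf \<gamma> t w} \<in> sets Sexp"
  by (intro Collect_in_Sexp; measurable)+

text \<open>On the cell \<open>step_fun\<close> is at most \<open>c\<close>, and \<open>Vf\<close>
  at \<open>T = Z_(r+1)\<close> is at most its value at 0; the enlarged event is a product.\<close>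

lemma prob_block_upper:
  assumes c: "\<And>z. 0 < z \<Longrightarrow> a \<le> z \<Longrightarrow> z < b \<Longrightarrow> step_fun \<gamma> z \<le> c"
  shows "Se.prob {w. (a \<le> Zs w (Suc r) \<and> Zs w (Suc r) < b) \<and> x < Yf \<gamma> r w}
    \<le> Se.prob {w. a \<le> Zs w (Suc r) \<and> Zs w (Suc r) < b} * Se.prob {w. x - c - Arg_sum r \<gamma> < Vf \<gamma> 0 w}"
proof -
  let ?X = "{w. (a \<le> Zs w (Suc r) \<and> Zs w (Suc r) < b) \<and> x < Yf \<gamma> r w}"
  let ?T = "{w. a \<le> Zs w (Suc r) \<and> Zs w (Suc r) < b}" and ?V = "{w. x - c - Arg_sum r \<gamma> < Vf \<gamma> 0 w}"
  have "Se.prob ?X = measure (Sexp \<Otimes>\<^sub>M Sexp) {p. comb_seq (Suc r) (fst p) (snd p) \<in> ?X}"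
    by (rule prob_comb_seq(1)) (rule events_block)
  also have "\<dots> \<le> measure (Sexp \<Otimes>\<^sub>M Sexp) (?T \<times> ?V)"
  proof (rule SP.P.finite_measure_mono_AE)
    show "?T \<times> ?V \<in> sets (Sexp \<Otimes>\<^sub>M Sexp)" by (intro pair_measureI events_block)
    show "AE p in Sexp \<Otimes>\<^sub>M Sexp. p \<in> {p. comb_seq (Suc r) (fst p) (snd p) \<in> ?X} \<longrightarrow> p \<in> ?T \<times> ?V"
      using AE_pair_regular_path
    proof eventually_elim
      case (elim p)
      obtain w' w where p: "p = (w', w)" by (cases p)
      let ?t = "Zs w' (Suc r)"
      have t: "0 < ?t" using elim by (intro Zs_pos) (auto simp: p)
      have "Yf \<gamma> r (comb_seq (Suc r) w' w) = step_fun \<gamma> ?t + Arg_sum r \<gamma> + Vf \<gamma> ?t w"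
        using elim t by (intro Yf_comb_seq g) (auto simp: p)
      moreover have "Vf \<gamma> ?t w \<le> Vf \<gamma> 0 w" using elim t by (intro Vf_antimono g) (auto simp: p)
      ultimately show ?case using c[of ?t] t by (auto simp: p Zs_comb_seq_le)
    qed
  qed
  also have "\<dots> = Se.prob ?T * Se.prob ?V" by (intro measure_Sexp_Times events_block)
  finally show ?thesis .
qed

text \<open>The mirror image: \<open>T < b <= t\<close> makes \<open>Vf\<close> at \<open>T\<close>
  at least its value at \<open>t\<close>, so a product event fits inside.\<close>

lemma prob_block_lower:
  assumes c: "\<And>z. 0 < z \<Longrightarrow> a \<le> z \<Longrightarrow> z < b \<Longrightarrow> c \<le> step_fun \<gamma> z" and t: "b \<le> t"
  shows "Se.prob {w. a \<le> Zs w (Suc r) \<and> Zs w (Suc r) < b} * Se.prob {w. x - c - Arg_sum r \<gamma> < Vf \<gamma> t w}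
    \<le> Se.prob {w. (a \<le> Zs w (Suc r) \<and> Zs w (Suc r) < b) \<and> x < Yf \<gamma> r w}"
proof -
  let ?X = "{w. (a \<le> Zs w (Suc r) \<and> Zs w (Suc r) < b) \<and> x < Yf \<gamma> r w}"
  let ?T = "{w. a \<le> Zs w (Suc r) \<and> Zs w (Suc r) < b}" and ?V = "{w. x - c - Arg_sum r \<gamma> < Vf \<gamma> t w}"
  have "Se.prob ?T * Se.prob ?V = measure (Sexp \<Otimes>\<^sub>M Sexp) (?T \<times> ?V)"
    by (intro measure_Sexp_Times[symmetric] events_block)
  also have "\<dots> \<le> measure (Sexp \<Otimes>\<^sub>M Sexp) {p. comb_seq (Suc r) (fst p) (snd p) \<in> ?X}"
  proof (rule SP.P.finite_measure_mono_AE)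
    show "{p. comb_seq (Suc r) (fst p) (snd p) \<in> ?X} \<in> sets (Sexp \<Otimes>\<^sub>M Sexp)"
      by (intro prob_comb_seq(2) events_block)
    show "AE p in Sexp \<Otimes>\<^sub>M Sexp. p \<in> ?T \<times> ?V \<longrightarrow> p \<in> {p. comb_seq (Suc r) (fst p) (snd p) \<in> ?X}"
      using AE_pair_regular_path
    proof eventually_elim
      case (elim p)
      obtain w' w where p: "p = (w', w)" by (cases p)
      let ?t = "Zs w' (Suc r)"
      have t0: "0 < ?t" using elim by (intro Zs_pos) (auto simp: p)
      have "Yf \<gamma> r (comb_seq (Suc r) w' w) = step_fun \<gamma> ?t + Arg_sum r \<gamma> + Vf \<gamma> ?t w"
        using elim t0 by (intro Yf_comb_seq g) (auto simp: p)
      moreover have "Vf \<gamma> t w \<le> Vf \<gamma> ?t w" if "?t < b" using elim t t0 that by (intro Vf_antimono g) (auto simp: p)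
      ultimately show ?case using c[of ?t] t0 by (auto simp: p Zs_comb_seq_le)
    qed
  qed
  also have "\<dots> = Se.prob ?X"
    by (rule prob_comb_seq(1)[symmetric]) (rule events_block)
  finally show ?thesis .
qed

end

subsection \<open>The tail asymptotics\<close>

text \<open>
  The dyadic point \<open>\<gamma>2\<^bsup>-N\<^esup>\<close>, where \<open>N\<close> is the integer part of \<open>log(\<gamma>x)\<close> to base 2.
\<close>

definition tail_scale :: "real \<Rightarrow> real \<Rightarrow> real" where
  "tail_scale \<gamma> x = 2 powr frac (log 2 (\<gamma> * x)) / x"

lemma tail_scale_bounds:
  assumes "x > 0"
  shows "0 < tail_scale \<gamma> x" "1 / x \<le> tail_scale \<gamma> x" "tail_scale \<gamma> x < 2 / x"
proof -
  have "1 \<le> 2 powr frac (log 2 (\<gamma> * x))" by (rule ge_one_powr_ge_zero) auto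
  moreover have "2 powr frac (log 2 (\<gamma> * x)) < 2 powr 1" by (rule powr_less_mono) (auto simp: frac_lt_1)
  ultimately show "0 < tail_scale \<gamma> x" "1 / x \<le> tail_scale \<gamma> x" "tail_scale \<gamma> x < 2 / x"
    using assms by (auto simp: tail_scale_def divide_right_mono divide_strict_right_mono)
qed

text \<open>Cell \<open>j\<close> relative to the jump point
  \<open>tail_scale \<gamma> x = \<gamma> * 2 powr (-N)\<close> is the dyadic cell with index
  \<open>j - N\<close>.\<close>

lemma step_fun_tail_scale:
  assumes g: "\<gamma> > 0" and x: "x > 0"
    and z: "tail_scale \<gamma> x * 2 powr of_int j \<le> z" "z < tail_scale \<gamma> x * 2 powr of_int (j + 1)"
  shows "step_fun \<gamma> z = 2 powr (- of_int j) / tail_scale \<gamma> x"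
proof -
  define N where "N = \<lfloor>log 2 (\<gamma> * x)\<rfloor>"
  define f where "f = frac (log 2 (\<gamma> * x))"
  have "\<gamma> * x = 2 powr (log 2 (\<gamma> * x))" using g x by simp
  also have "log 2 (\<gamma> * x) = of_int N + f" by (simp add: N_def f_def frac_def)
  finally have gx: "\<gamma> * x = 2 powr of_int N * 2 powr f" by (simp add: powr_add)
  have "tail_scale \<gamma> x = 2 powr f / x" by (simp add: tail_scale_def f_def)
  also have "2 powr f = (\<gamma> * x) * 2 powr (- of_int N)" unfolding gx by (simp add: powr_minus)
  also have "\<dots> / x = \<gamma> * 2 powr (- of_int N)" using x by simp
  finally have a: "tail_scale \<gamma> x = \<gamma> * 2 powr (- of_int N)" .
  have "step_fun \<gamma> z = 2 powr (- of_int (j - N)) / \<gamma>"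
  proof (rule step_fun_dyadic[OF g])
    show "\<gamma> * 2 powr of_int (j - N) \<le> z"
      using z(1) unfolding a mult.assoc powr_add[symmetric] by simp
    show "z < \<gamma> * 2 powr of_int (j - N + 1)"
      using z(2) unfolding a mult.assoc powr_add[symmetric] by (simp add: algebra_simps)
  qed
  also have "\<dots> = 2 powr (- of_int j) / tail_scale \<gamma> x"
    by (simp add: a powr_minus powr_diff field_simps)
  finally show ?thesis .
qed

text \<open>The chance of \<open>Y_r > x\<close> once \<open>step_fun\<close> at \<open>T\<close>
  has the value \<open>c\<close> and the small shift \<open>T\<close> in \<open>Vf\<close> is
  replaced by 0.\<close>

definition Qtail :: "real \<Rightarrow> nat \<Rightarrow> real \<Rightarrow> real \<Rightarrow> real" where
  "Qtail \<gamma> r x c = Se.prob {w. x - c - Arg_sum r \<gamma> < Vf \<gamma> 0 w}"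

text \<open>For \<open>x > 0\<close> this is the right-hand side of the theorem
  (\<open>main_term_eq\<close>). With \<open>a = tail_scale \<gamma> x\<close>, the summand
  \<open>1 / 2 ^ Suc r\<close> comes from the cell \<open>[0, a/2)\<close>, the \<open>Qtail\<close>
  terms from \<open>[a, 2a)\<close> and \<open>[a/2, a)\<close>.\<close>

definition main_term :: "real \<Rightarrow> nat \<Rightarrow> real \<Rightarrow> real" where
  "main_term \<gamma> r x = tail_scale \<gamma> x ^ Suc r / fact (Suc r) *
     (1 / 2 ^ Suc r + (2 ^ Suc r - 1) * (Qtail \<gamma> r x (1 / tail_scale \<gamma> x) + Qtail \<gamma> r x (2 / tail_scale \<gamma> x) / 2 ^ Suc r))"

lemma main_term_ge:
  assumes "x > 0"
  shows "tail_scale \<gamma> x ^ Suc r / fact (Suc r) / 2 ^ Suc r \<le> main_term \<gamma> r x"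
proof -
  have "(1::real) \<le> 2 ^ Suc r" by (rule one_le_power) simp
  then have "1 / 2 ^ Suc r \<le> 1 / 2 ^ Suc r + (2 ^ Suc r - 1) * (Qtail \<gamma> r x (1 / tail_scale \<gamma> x) + Qtail \<gamma> r x (2 / tail_scale \<gamma> x) / 2 ^ Suc r)"
    by (simp add: Qtail_def)
  then have "tail_scale \<gamma> x ^ Suc r / fact (Suc r) * (1 / 2 ^ Suc r) \<le> main_term \<gamma> r x"
    unfolding main_term_def using tail_scale_bounds(1)[OF assms, of \<gamma>] by (intro mult_left_mono) auto
  then show ?thesis by simp
qed

section \<open>Contributions of the three cells\<close>

abbreviation cell :: "nat \<Rightarrow> real \<Rightarrow> real \<Rightarrow> (nat \<Rightarrow> real) set" where
  "cell r u v \<equiv> {w. u \<le> Zs w (Suc r) \<and> Zs w (Suc r) < v}"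

abbreviation cellY :: "real \<Rightarrow> nat \<Rightarrow> real \<Rightarrow> real \<Rightarrow> real \<Rightarrow> (nat \<Rightarrow> real) set" where
  "cellY \<gamma> r x u v \<equiv> {w. (u \<le> Zs w (Suc r) \<and> Zs w (Suc r) < v) \<and> x < Yf \<gamma> r w}"

context
  fixes \<gamma> x a :: real and r :: nat
  assumes g: "\<gamma> > 0" and x: "x > 0" and a: "a = tail_scale \<gamma> x"
begin

text \<open>The points \<open>a / 2\<close>, \<open>a\<close> and \<open>2 * a\<close> are
  consecutive jump points. The last bound connects the range beyond \<open>2 * a\<close> with
  \<open>prob_Yf_large_step_fun_small\<close>.\<close>

lemma cell_values:
  "a \<le> z \<Longrightarrow> z < 2 * a \<Longrightarrow> step_fun \<gamma> z = 1 / a"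
  "a / 2 \<le> z \<Longrightarrow> z < a \<Longrightarrow> step_fun \<gamma> z = 2 / a"
  "0 < z \<Longrightarrow> z < a / 2 \<Longrightarrow> 4 / a \<le> step_fun \<gamma> z"
  "2 * a \<le> z \<Longrightarrow> step_fun \<gamma> z \<le> x / 2"
proof -
  note ab = tail_scale_bounds[OF x, of \<gamma>, folded a]
  have e: "2 powr (-2) = (1 / 4 :: real)" "2 powr (-1) = (1 / 2 :: real)" "2 powr 2 = (4::real)"
    using powr_realpow[of 2 2] powr_minus[of "2::real" 2] powr_minus[of "2::real" 1] by auto
  show "a \<le> z \<Longrightarrow> z < 2 * a \<Longrightarrow> step_fun \<gamma> z = 1 / a"
    using step_fun_tail_scale[OF g x, of 0 z, folded a] by (simp add: mult.commute)
  show "a / 2 \<le> z \<Longrightarrow> z < a \<Longrightarrow> step_fun \<gamma> z = 2 / a"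
    using step_fun_tail_scale[OF g x, of "-1" z, folded a] by (simp add: e)
  show "4 / a \<le> step_fun \<gamma> z" if "0 < z" "z < a / 2"
  proof -
    \<comment> \<open>Points below \<open>a / 4\<close> are moved up into the cell
      \<open>[a/4, a/2)\<close>, where the value is exactly \<open>4 / a\<close>; monotonicity does
      the rest.\<close>
    have "step_fun \<gamma> (max z (a / 4)) = 4 / a"
      using step_fun_tail_scale[OF g x, of "-2" "max z (a / 4)", folded a] that ab by (simp add: e)
    moreover have "step_fun \<gamma> (max z (a / 4)) \<le> step_fun \<gamma> z" using that by (intro step_fun_antimono g) auto
    ultimately show ?thesis by simp
  qed
  show "step_fun \<gamma> z \<le> x / 2" if "2 * a \<le> z"
  proof -
    have "step_fun \<gamma> z \<le> step_fun \<gamma> (2 * a)" using that ab by (intro step_fun_antimono g) auto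
    also have "\<dots> = 1 / (2 * a)"
      using step_fun_tail_scale[OF g x, of 1 "2 * a", folded a] ab by (simp add: e)
    also have "\<dots> \<le> x / 2" using ab(1,2) x by (simp add: field_simps)
    finally show ?thesis .
  qed
qed

text \<open>All cells lie in \<open>[0, 2 * a)\<close>, so \<open>exp (-2 * a)\<close> is a common
  lower bound for the exponential factor of the density.\<close>

lemma prob_cells:
  shows "Se.prob (cell r a (2 * a)) \<le> a ^ Suc r / fact (Suc r) * (2 ^ Suc r - 1)"
    and "exp (-2 * a) * (a ^ Suc r / fact (Suc r) * (2 ^ Suc r - 1)) \<le> Se.prob (cell r a (2 * a))"
    and "Se.prob (cell r (a / 2) a) \<le> a ^ Suc r / fact (Suc r) * (1 - 1 / 2 ^ Suc r)"
    and "exp (-2 * a) * (a ^ Suc r / fact (Suc r) * (1 - 1 / 2 ^ Suc r)) \<le> Se.prob (cell r (a / 2) a)"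
    and "Se.prob (cell r 0 (a / 2)) \<le> a ^ Suc r / fact (Suc r) * (1 / 2 ^ Suc r)"
    and "exp (-2 * a) * (a ^ Suc r / fact (Suc r) * (1 / 2 ^ Suc r)) \<le> Se.prob (cell r 0 (a / 2))"
proof -
  note ab = tail_scale_bounds(1)[OF x, of \<gamma>, folded a]
  have low: "exp (-2 * a) * ((v ^ Suc r - u ^ Suc r) / fact (Suc r)) \<le> Se.prob (cell r u v)"
    if "0 \<le> u" "u \<le> v" "v \<le> 2 * a" for u v
  proof -
    have "u ^ Suc r \<le> v ^ Suc r" using that by (intro power_mono) auto
    then have "exp (-2 * a) * ((v ^ Suc r - u ^ Suc r) / fact (Suc r)) \<le> exp (-v) * ((v ^ Suc r - u ^ Suc r) / fact (Suc r))"
      using that by (intro mult_right_mono divide_nonneg_pos) auto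
    also have "\<dots> \<le> Se.prob (cell r u v)" by (rule prob_Zs_le) (use that in auto)
    finally show ?thesis .
  qed
  have e: "((2 * a) ^ Suc r - a ^ Suc r) / fact (Suc r) = a ^ Suc r / fact (Suc r) * (2 ^ Suc r - 1)"
    "(a ^ Suc r - (a / 2) ^ Suc r) / fact (Suc r) = a ^ Suc r / fact (Suc r) * (1 - 1 / 2 ^ Suc r)"
    "((a / 2) ^ Suc r - 0 ^ Suc r) / fact (Suc r) = a ^ Suc r / fact (Suc r) * (1 / 2 ^ Suc r)"
    by (simp_all only: power_mult_distrib power_divide) (simp_all add: field_simps del: fact_Suc)
  show "Se.prob (cell r a (2 * a)) \<le> a ^ Suc r / fact (Suc r) * (2 ^ Suc r - 1)"
    "Se.prob (cell r (a / 2) a) \<le> a ^ Suc r / fact (Suc r) * (1 - 1 / 2 ^ Suc r)"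
    "Se.prob (cell r 0 (a / 2)) \<le> a ^ Suc r / fact (Suc r) * (1 / 2 ^ Suc r)"
    unfolding e[symmetric] by (rule prob_Zs_le(1); use ab in simp)+
  show "exp (-2 * a) * (a ^ Suc r / fact (Suc r) * (2 ^ Suc r - 1)) \<le> Se.prob (cell r a (2 * a))"
    "exp (-2 * a) * (a ^ Suc r / fact (Suc r) * (1 - 1 / 2 ^ Suc r)) \<le> Se.prob (cell r (a / 2) a)"
    "exp (-2 * a) * (a ^ Suc r / fact (Suc r) * (1 / 2 ^ Suc r)) \<le> Se.prob (cell r 0 (a / 2))"
    unfolding e[symmetric] by (rule low; use ab in simp)+
qed

text \<open>If \<open>step_fun\<close> at \<open>T\<close> exceeds \<open>x / 2\<close>, then
  \<open>T < 2 * a\<close> lies in one of the three cells. On the lowest one the condition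
  \<open>x < Yf \<gamma> r w\<close> is dropped.\<close>

lemma Yf_tail_upper:
  "Se.prob {w. x < Yf \<gamma> r w} \<le> Se.prob {w. x < Yf \<gamma> r w \<and> step_fun \<gamma> (Zs w (Suc r)) \<le> x / 2} + main_term \<gamma> r x"
proof -
  note ab = tail_scale_bounds(1)[OF x, of \<gamma>, folded a]
  let ?R = "{w. x < Yf \<gamma> r w \<and> step_fun \<gamma> (Zs w (Suc r)) \<le> x / 2}"
  have [measurable]: "?R \<in> sets Sexp" by (intro Collect_in_Sexp; measurable)
  have [measurable]: "cell r u v \<in> sets Sexp" "cellY \<gamma> r x u v \<in> sets Sexp" for u v by (intro Collect_in_Sexp; measurable)+
  have "Se.prob {w. x < Yf \<gamma> r w} \<le> Se.prob (?R \<union> (cellY \<gamma> r x a (2 * a) \<union> (cellY \<gamma> r x (a / 2) a \<union> cell r 0 (a / 2))))"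
  proof (rule Se.finite_measure_mono_AE)
    show "AE w in Sexp. w \<in> {w. x < Yf \<gamma> r w} \<longrightarrow> w \<in> ?R \<union> (cellY \<gamma> r x a (2 * a) \<union> (cellY \<gamma> r x (a / 2) a \<union> cell r 0 (a / 2)))"
      using AE_pos
    proof eventually_elim
      case (elim w)
      have "0 < Zs w (Suc r)" using elim by (intro Zs_pos) auto
      then show ?case using cell_values(4)[of "Zs w (Suc r)"] by auto
    qed
  qed measurable
  also have "\<dots> \<le> Se.prob ?R + Se.prob (cellY \<gamma> r x a (2 * a) \<union> (cellY \<gamma> r x (a / 2) a \<union> cell r 0 (a / 2)))"
    by (intro measure_Un_le) measurable
  also have "Se.prob (cellY \<gamma> r x a (2 * a) \<union> (cellY \<gamma> r x (a / 2) a \<union> cell r 0 (a / 2))) \<le> Se.prob (cellY \<gamma> r x a (2 * a)) + Se.prob (cellY \<gamma> r x (a / 2) a \<union> cell r 0 (a / 2))"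
    by (intro measure_Un_le) measurable
  also have "Se.prob (cellY \<gamma> r x (a / 2) a \<union> cell r 0 (a / 2)) \<le> Se.prob (cellY \<gamma> r x (a / 2) a) + Se.prob (cell r 0 (a / 2))"
    by (intro measure_Un_le) measurable
  also have "Se.prob (cellY \<gamma> r x a (2 * a)) \<le> Se.prob (cell r a (2 * a)) * Qtail \<gamma> r x (1 / a)"
    unfolding Qtail_def using ab by (intro prob_block_upper g) (auto simp: cell_values)
  also have "\<dots> \<le> a ^ Suc r / fact (Suc r) * (2 ^ Suc r - 1) * Qtail \<gamma> r x (1 / a)"
    by (intro mult_right_mono prob_cells) (auto simp: Qtail_def)
  also have "Se.prob (cellY \<gamma> r x (a / 2) a) \<le> Se.prob (cell r (a / 2) a) * Qtail \<gamma> r x (2 / a)"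
    unfolding Qtail_def using ab by (intro prob_block_upper g) (auto simp: cell_values)
  also have "\<dots> \<le> a ^ Suc r / fact (Suc r) * (1 - 1 / 2 ^ Suc r) * Qtail \<gamma> r x (2 / a)"
    by (intro mult_right_mono prob_cells) (auto simp: Qtail_def)
  also have "Se.prob (cell r 0 (a / 2)) \<le> a ^ Suc r / fact (Suc r) * (1 / 2 ^ Suc r)" by (rule prob_cells)
  finally have "Se.prob {w. x < Yf \<gamma> r w} \<le> Se.prob ?R + (a ^ Suc r / fact (Suc r) * (2 ^ Suc r - 1) * Qtail \<gamma> r x (1 / a)
    + (a ^ Suc r / fact (Suc r) * (1 - 1 / 2 ^ Suc r) * Qtail \<gamma> r x (2 / a) + a ^ Suc r / fact (Suc r) * (1 / 2 ^ Suc r)))"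
    by simp
  also have "D * (c - 1) * q0 + (D * (1 - 1 / c) * q1 + D * (1 / c)) = D * (1 / c + (c - 1) * (q0 + q1 / c))"
    if "c > 0" for D c q0 q1 :: real using that by (simp add: field_simps)
  from this[of "2 ^ Suc r" "a ^ Suc r / fact (Suc r)"]
  have "(a ^ Suc r / fact (Suc r) * (2 ^ Suc r - 1) * Qtail \<gamma> r x (1 / a)
    + (a ^ Suc r / fact (Suc r) * (1 - 1 / 2 ^ Suc r) * Qtail \<gamma> r x (2 / a) + a ^ Suc r / fact (Suc r) * (1 / 2 ^ Suc r))) = main_term \<gamma> r x"
    unfolding main_term_def a by simp
  finally show ?thesis .
qed

text \<open>The additive shift errors become relative ones through
  \<open>D <= main_term \<gamma> r x * c\<close> with \<open>c = 2 ^ Suc r\<close>; together with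
  the factor \<open>c\<close> in the total loss this gives \<open>4 ^ Suc r\<close>.\<close>

lemma Yf_tail_lower:
  assumes eps: "0 \<le> \<epsilon>" and shift: "\<And>y. Se.prob {w. y < Vf \<gamma> 0 w} \<le> Se.prob {w. y < Vf \<gamma> (2 * a) w} + \<epsilon>"
    and tail: "1 - \<epsilon> \<le> Qtail \<gamma> r x (4 / a)"
  shows "exp (-2 * a) * (main_term \<gamma> r x * (1 - 2 * \<epsilon> * 4 ^ Suc r)) \<le> Se.prob {w. x < Yf \<gamma> r w}"
proof -
  note ab = tail_scale_bounds(1)[OF x, of \<gamma>, folded a]
  define D where "D = a ^ Suc r / fact (Suc r)"
  define c :: real where "c = 2 ^ Suc r"
  define q where "q y = Se.prob {w. x - y - Arg_sum r \<gamma> < Vf \<gamma> (2 * a) w}" for y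
  have D0: "0 < D" using ab by (simp add: D_def)
  have c2: "2 \<le> c" unfolding c_def by simp
  have qQ: "Qtail \<gamma> r x y - \<epsilon> \<le> q y" for y
    using shift[of "x - y - Arg_sum r \<gamma>"] by (simp add: Qtail_def q_def)
  have Q01: "Qtail \<gamma> r x y \<le> 1" "0 \<le> Qtail \<gamma> r x y" "0 \<le> q y" for y by (auto simp: Qtail_def q_def)
  have [measurable]: "cellY \<gamma> r x u v \<in> sets Sexp" for u v by (intro Collect_in_Sexp; measurable)+
  have sub: "cellY \<gamma> r x a (2 * a) \<union> (cellY \<gamma> r x (a / 2) a \<union> cellY \<gamma> r x 0 (a / 2)) \<subseteq> {w. x < Yf \<gamma> r w}" by auto
  have "main_term \<gamma> r x = D * (1 / c + (c - 1) * (Qtail \<gamma> r x (1 / a) + Qtail \<gamma> r x (2 / a) / c))"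
    by (simp add: main_term_def D_def c_def a)
  also have "\<dots> = D * (c - 1) * Qtail \<gamma> r x (1 / a) + D * (1 - 1 / c) * Qtail \<gamma> r x (2 / a) + D * (1 / c)"
    using c2 by (simp add: field_simps)
  finally have m: "main_term \<gamma> r x = D * (c - 1) * Qtail \<gamma> r x (1 / a) + D * (1 - 1 / c) * Qtail \<gamma> r x (2 / a) + D * (1 / c)" .
  have Dc: "D / c \<le> main_term \<gamma> r x" unfolding D_def c_def a by (rule main_term_ge[OF x])
  have "main_term \<gamma> r x * (1 - 2 * \<epsilon> * 4 ^ Suc r) = main_term \<gamma> r x - 2 * \<epsilon> * c * (main_term \<gamma> r x * c)"
    by (simp add: c_def power_mult_distrib[symmetric] algebra_simps)
  also have "\<dots> \<le> main_term \<gamma> r x - 2 * \<epsilon> * c * D"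
  proof -
    have "D \<le> main_term \<gamma> r x * c" using Dc c2 by (simp add: field_simps)
    then have "2 * \<epsilon> * c * D \<le> 2 * \<epsilon> * c * (main_term \<gamma> r x * c)"
      using eps c2 by (intro mult_left_mono) auto
    then show ?thesis by simp
  qed
  \<comment> \<open>The lowest cell carries \<open>1 - 2 * \<epsilon>\<close>: one
    \<open>\<epsilon>\<close> from \<open>tail\<close>, one from \<open>shift\<close>.\<close>
  also have "\<dots> \<le> D * (c - 1) * (Qtail \<gamma> r x (1 / a) - \<epsilon>) + D * (1 - 1 / c) * (Qtail \<gamma> r x (2 / a) - \<epsilon>) + D * (1 / c) * (1 - 2 * \<epsilon>)"
  proof -
    have "D * (c - 1) * \<epsilon> + D * (1 - 1 / c) * \<epsilon> + D * (1 / c) * (2 * \<epsilon>) = D * \<epsilon> * (c + 1 / c)"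
      using c2 by (simp add: field_simps)
    also have "\<dots> \<le> D * \<epsilon> * (2 * c)"
      using c2 eps D0 by (intro mult_left_mono) (auto simp: field_simps intro: order_trans[of _ "2 * c"])
    finally show ?thesis unfolding m by (simp add: algebra_simps)
  qed
  also have "\<dots> \<le> D * (c - 1) * q (1 / a) + D * (1 - 1 / c) * q (2 / a) + D * (1 / c) * q (4 / a)"
    using D0 c2 qQ[of "1 / a"] qQ[of "2 / a"] qQ[of "4 / a"] tail
    by (intro add_mono mult_left_mono) auto
  finally have "exp (-2 * a) * (main_term \<gamma> r x * (1 - 2 * \<epsilon> * 4 ^ Suc r)) \<le>
     exp (-2 * a) * (D * (c - 1) * q (1 / a) + D * (1 - 1 / c) * q (2 / a) + D * (1 / c) * q (4 / a))"
    by (intro mult_left_mono) auto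
  also have "\<dots> = (exp (-2 * a) * (D * (c - 1))) * q (1 / a) + (exp (-2 * a) * (D * (1 - 1 / c))) * q (2 / a) + (exp (-2 * a) * (D * (1 / c))) * q (4 / a)"
    by (simp add: algebra_simps)
  also have "\<dots> \<le> Se.prob (cell r a (2 * a)) * q (1 / a) + Se.prob (cell r (a / 2) a) * q (2 / a) + Se.prob (cell r 0 (a / 2)) * q (4 / a)"
    unfolding D_def c_def by (intro add_mono mult_right_mono prob_cells Q01)
  also have "\<dots> \<le> Se.prob (cellY \<gamma> r x a (2 * a)) + Se.prob (cellY \<gamma> r x (a / 2) a) + Se.prob (cellY \<gamma> r x 0 (a / 2))"
    unfolding q_def using ab by (intro add_mono prob_block_lower g) (auto simp: cell_values)
  also have "\<dots> = Se.prob (cellY \<gamma> r x a (2 * a) \<union> (cellY \<gamma> r x (a / 2) a \<union> cellY \<gamma> r x 0 (a / 2)))"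
  proof -
    have "Se.prob (cellY \<gamma> r x a (2 * a) \<union> (cellY \<gamma> r x (a / 2) a \<union> cellY \<gamma> r x 0 (a / 2))) = Se.prob (cellY \<gamma> r x a (2 * a)) + Se.prob (cellY \<gamma> r x (a / 2) a \<union> cellY \<gamma> r x 0 (a / 2))"
    proof (rule Se.finite_measure_Union)
      show "cellY \<gamma> r x a (2 * a) \<inter> (cellY \<gamma> r x (a / 2) a \<union> cellY \<gamma> r x 0 (a / 2)) = {}" using ab by auto
    qed measurable
    also have "Se.prob (cellY \<gamma> r x (a / 2) a \<union> cellY \<gamma> r x 0 (a / 2)) = Se.prob (cellY \<gamma> r x (a / 2) a) + Se.prob (cellY \<gamma> r x 0 (a / 2))"
    proof (rule Se.finite_measure_Union)
      show "cellY \<gamma> r x (a / 2) a \<inter> cellY \<gamma> r x 0 (a / 2) = {}" using ab by auto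
    qed measurable
    finally show ?thesis by simp
  qed
  also have "\<dots> \<le> Se.prob {w. x < Yf \<gamma> r w}"
    by (intro Se.finite_measure_mono sub Collect_in_Sexp) measurable
  finally show ?thesis .
qed

end

text \<open>As \<open>tail_scale \<gamma> x < 2 / x\<close>, the jump
  \<open>4 / tail_scale \<gamma> x\<close> is at least \<open>2 * x\<close>; the threshold left for
  \<open>Vf\<close> is at most \<open>- x - Arg_sum r \<gamma>\<close> and tends to minus
  infinity.\<close>

lemma eventually_Qtail_ge:
  assumes e: "\<epsilon> > 0"
  shows "eventually (\<lambda>x. 1 - \<epsilon> \<le> Qtail \<gamma> r x (4 / tail_scale \<gamma> x)) at_top"
proof -
  define \<mu> where "\<mu> = distr Sexp borel (Vf \<gamma> 0)"
  interpret real_distribution \<mu> unfolding \<mu>_def by (rule Se.real_distribution_distr) measurable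
  obtain B where B: "\<And>y. y \<le> B \<Longrightarrow> cdf \<mu> y < \<epsilon>"
    using order_tendstoD(2)[OF cdf_lim_at_bot, of \<epsilon>] e by (auto simp: eventually_at_bot_linorder)
  show ?thesis
    using eventually_ge_at_top[of "max 1 (- B - Arg_sum r \<gamma>)"]
  proof eventually_elim
    case (elim x)
    then have x: "x > 0" "- x - Arg_sum r \<gamma> \<le> B" by auto
    have "4 / tail_scale \<gamma> x \<ge> 2 * x"
      unfolding pos_le_divide_eq[OF tail_scale_bounds(1)[OF x(1)]]
      using tail_scale_bounds(3)[OF x(1), of \<gamma>] x(1) by (simp add: field_simps)
    then have y: "x - 4 / tail_scale \<gamma> x - Arg_sum r \<gamma> \<le> B" using x by linarith
    let ?y = "x - 4 / tail_scale \<gamma> x - Arg_sum r \<gamma>"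
    have "cdf \<mu> ?y = Se.prob {w. Vf \<gamma> 0 w \<le> ?y}"
      unfolding \<mu>_def cdf_def by (subst measure_distr) (auto simp: vimage_def)
    moreover have "Se.prob (space Sexp - {w. Vf \<gamma> 0 w \<le> ?y}) = 1 - Se.prob {w. Vf \<gamma> 0 w \<le> ?y}"
      by (intro Se.prob_compl Collect_in_Sexp) measurable
    moreover have "space Sexp - {w. Vf \<gamma> 0 w \<le> ?y} = {w. ?y < Vf \<gamma> 0 w}" by auto
    ultimately show ?case using B[OF y] by (simp add: Qtail_def)
  qed
qed

text \<open>From \<open>tail_scale \<gamma> x >= 1 / x\<close>. It makes remainders that vanish
  after multiplication by \<open>x ^ Suc r\<close> negligible relative to the main term.\<close>

lemma main_term_lower:
  assumes "x > 0"
  shows "1 / (fact (Suc r) * 2 ^ Suc r) \<le> x ^ Suc r * main_term \<gamma> r x"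
proof -
  have "(1 / x) ^ Suc r / fact (Suc r) / 2 ^ Suc r \<le> tail_scale \<gamma> x ^ Suc r / fact (Suc r) / 2 ^ Suc r"
    using tail_scale_bounds[OF assms, of \<gamma>] assms by (intro divide_right_mono power_mono) auto
  also have "\<dots> \<le> main_term \<gamma> r x" by (rule main_term_ge[OF assms])
  finally have "x ^ Suc r * ((1 / x) ^ Suc r / fact (Suc r) / 2 ^ Suc r) \<le> x ^ Suc r * main_term \<gamma> r x"
    using assms by (intro mult_left_mono) auto
  moreover have "x ^ Suc r * ((1 / x) ^ Suc r / fact (Suc r) / 2 ^ Suc r) = 1 / (fact (Suc r) * 2 ^ Suc r)"
    using assms by (simp add: power_one_over del: fact_Suc power_Suc)
  ultimately show ?thesis by simp
qed

lemma main_term_pos: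
  assumes "x > 0"
  shows "0 < main_term \<gamma> r x"
proof -
  have "0 < tail_scale \<gamma> x ^ Suc r / fact (Suc r) / 2 ^ Suc r"
    using tail_scale_bounds(1)[OF assms] by (intro divide_pos_pos zero_less_power fact_gt_zero) auto
  then show ?thesis using main_term_ge[OF assms] by (rule order.strict_trans2)
qed

lemma Yf_tail_asymp_equiv:
  assumes g: "\<gamma> > 0"
  shows "(\<lambda>x. Se.prob {w. x < Yf \<gamma> r w}) \<sim>[at_top] main_term \<gamma> r"
proof (rule asymp_equivI', rule order_tendstoI)
  fix l :: real assume l: "l < 1"
  \<comment> \<open>Chosen so that the relative loss \<open>2 * \<epsilon> * 4 ^ Suc r\<close> is
    half the gap \<open>1 - l\<close>.\<close>
  define \<epsilon> where "\<epsilon> = (1 - l) / (4 * 4 ^ Suc r)"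
  have e0: "\<epsilon> > 0" using l by (simp add: \<epsilon>_def)
  have "2 * \<epsilon> * 4 ^ Suc r = (1 - l) / 2" by (simp add: \<epsilon>_def)
  then have e1: "l < 1 - 2 * \<epsilon> * 4 ^ Suc r" using l by simp
  obtain \<tau> where \<tau>: "\<tau> > 0" "\<And>t y. t \<in> {0..\<tau>} \<Longrightarrow> Se.prob {w. y < Vf \<gamma> 0 w} \<le> Se.prob {w. y < Vf \<gamma> t w} + \<epsilon>"
    using prob_Vf_shift_uniform[OF g e0] by blast
  have "((\<lambda>x::real. exp (- 4 / x) * (1 - 2 * \<epsilon> * 4 ^ Suc r)) \<longlongrightarrow> 1 * (1 - 2 * \<epsilon> * 4 ^ Suc r)) at_top"
    by (intro tendsto_mult tendsto_const) real_asymp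
  then have "eventually (\<lambda>x::real. l < exp (- 4 / x) * (1 - 2 * \<epsilon> * 4 ^ Suc r)) at_top"
    using e1 by (intro order_tendstoD) auto
  \<comment> \<open>For \<open>x >= 4 / \<tau>\<close> the shift
    \<open>2 * tail_scale \<gamma> x\<close>, being below \<open>4 / x\<close>, is at most
    \<open>\<tau>\<close>.\<close>
  moreover have "eventually (\<lambda>x::real. x \<ge> max 1 (4 / \<tau>)) at_top" by (rule eventually_ge_at_top)
  ultimately show "eventually (\<lambda>x. l < Se.prob {w. x < Yf \<gamma> r w} / main_term \<gamma> r x) at_top"
    using eventually_Qtail_ge[OF e0, of \<gamma> r]
  proof eventually_elim
    case (elim x)
    then have x: "x > 0" "4 / \<tau> \<le> x" by auto
    note ab = tail_scale_bounds[OF x(1), of \<gamma>]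
    have "4 / x \<le> \<tau>" using x \<tau>(1) by (simp add: field_simps)
    then have t: "2 * tail_scale \<gamma> x \<in> {0..\<tau>}" using ab by auto
    have "exp (- 2 * tail_scale \<gamma> x) * (main_term \<gamma> r x * (1 - 2 * \<epsilon> * 4 ^ Suc r)) \<le> Se.prob {w. x < Yf \<gamma> r w}"
      by (rule Yf_tail_lower[OF g x(1) refl]) (use e0 \<tau>(2)[OF t] elim in auto)
    then have "exp (- 2 * tail_scale \<gamma> x) * (1 - 2 * \<epsilon> * 4 ^ Suc r) \<le> Se.prob {w. x < Yf \<gamma> r w} / main_term \<gamma> r x"
      using main_term_pos[OF x(1), of \<gamma> r] by (simp only: pos_le_divide_eq) (simp only: mult_ac)
    moreover have "l < exp (- 2 * tail_scale \<gamma> x) * (1 - 2 * \<epsilon> * 4 ^ Suc r)"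
    \<comment> \<open>For very negative \<open>l\<close> the factor is negative; multiplying it by
      an exponential that is at most 1 then only increases it.\<close>
    proof (cases "0 \<le> 1 - 2 * \<epsilon> * 4 ^ Suc r")
      case True
      have "exp (- 4 / x) \<le> exp (- 2 * tail_scale \<gamma> x)" using ab by simp
      then have "exp (- 4 / x) * (1 - 2 * \<epsilon> * 4 ^ Suc r) \<le> exp (- 2 * tail_scale \<gamma> x) * (1 - 2 * \<epsilon> * 4 ^ Suc r)"
        using True by (rule mult_right_mono)
      then show ?thesis using elim(1) by linarith
    next
      case False
      then have "1 * (1 - 2 * \<epsilon> * 4 ^ Suc r) \<le> exp (- 2 * tail_scale \<gamma> x) * (1 - 2 * \<epsilon> * 4 ^ Suc r)"
        using ab by (intro mult_right_mono_neg) auto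
      with e1 show ?thesis unfolding mult_1 by (rule order.strict_trans2)
    qed
    ultimately show ?case by linarith
  qed
next
  fix u :: real assume u: "1 < u"
  define K :: real where "K = 1 / (fact (Suc r) * 2 ^ Suc r)"
  have K: "K > 0" by (simp add: K_def del: fact_Suc)
  let ?R = "\<lambda>x. Se.prob {w. x < Yf \<gamma> r w \<and> step_fun \<gamma> (Zs w (Suc r)) \<le> x / 2}"
  have "eventually (\<lambda>x. x ^ Suc r * ?R x < (u - 1) * K) at_top"
    using prob_Yf_large_step_fun_small[OF g] by (rule order_tendstoD) (use u K in auto)
  then show "eventually (\<lambda>x. Se.prob {w. x < Yf \<gamma> r w} / main_term \<gamma> r x < u) at_top"
    using eventually_gt_at_top[of 0]
  proof eventually_elim
    case (elim x)
    note elim(1)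
    also have "(u - 1) * K \<le> (u - 1) * (x ^ Suc r * main_term \<gamma> r x)"
      using u unfolding K_def by (intro mult_left_mono main_term_lower elim(2)) auto
    also have "\<dots> = x ^ Suc r * ((u - 1) * main_term \<gamma> r x)" by (simp only: mult_ac)
    finally have "?R x < (u - 1) * main_term \<gamma> r x"
      using elim(2) by (subst (asm) mult_less_cancel_left_pos) auto
    then have "Se.prob {w. x < Yf \<gamma> r w} < u * main_term \<gamma> r x"
      using Yf_tail_upper[OF g elim(2) refl, of r] by (simp add: algebra_simps)
    then show ?case using main_term_pos[OF elim(2), of \<gamma> r] by (simp add: pos_divide_less_eq)
  qed
qed

text \<open>With \<open>f = frac (log 2 (\<gamma> * x))\<close>, the quantity
  \<open>x * 2 powr (l - f)\<close> is \<open>2 ^ l / tail_scale \<gamma> x\<close>, the value of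
  \<open>step_fun\<close> on one of the two upper cells.\<close>

lemma main_term_eq:
  assumes x: "x > 0"
  shows "main_term \<gamma> r x = 2 powr (frac (log 2 (\<gamma> * x)) * real (r + 1)) / (fact (r + 1) * x ^ (r + 1)) *
      (2 powr (- real (r + 1)) + (2 ^ (r + 1) - 1) *
        (\<Sum>l\<in>{0..1::nat}. 2 powr (- (real l * real (r + 1))) *
           Se.prob {w. Yf \<gamma> 0 w + Arg_sum r \<gamma> > x * (1 - 2 powr (real l - frac (log 2 (\<gamma> * x))))}))"
proof -
  define f where "f = frac (log 2 (\<gamma> * x))"
  have a: "tail_scale \<gamma> x = 2 powr f / x" by (simp add: tail_scale_def f_def)
  have p: "2 powr (- real (r + 1)) = (1 / 2 ^ Suc r :: real)"
    by (simp only: powr_minus powr_realpow[of 2] zero_less_numeral Suc_eq_plus1 inverse_eq_divide)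
  have "2 powr (f * real (r + 1)) = (2 powr f) ^ Suc r"
    by (simp add: powr_powr[symmetric] powr_realpow[symmetric] del: of_nat_Suc power_Suc)
  then have D: "2 powr (f * real (r + 1)) / (fact (r + 1) * x ^ (r + 1)) = tail_scale \<gamma> x ^ Suc r / fact (Suc r)"
    by (simp only: a power_divide Suc_eq_plus1) (simp add: field_simps)
  have Q: "Se.prob {w. Yf \<gamma> 0 w + Arg_sum r \<gamma> > x * (1 - 2 powr (real l - f))} = Qtail \<gamma> r x (2 ^ l / tail_scale \<gamma> x)" for l
  proof -
    have "x * 2 powr (real l - f) = 2 ^ l / tail_scale \<gamma> x"
      by (simp add: a powr_diff powr_realpow)
    then have "x * (1 - 2 powr (real l - f)) < y + A \<longleftrightarrow> x - 2 ^ l / tail_scale \<gamma> x - A < y" for y A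
      by (simp add: right_diff_distrib) linarith
    then show ?thesis by (simp add: Qtail_def Yf_0)
  qed
  have s: "(\<Sum>l\<in>{0..1::nat}. 2 powr (- (real l * real (r + 1))) * Qtail \<gamma> r x (2 ^ l / tail_scale \<gamma> x))
    = Qtail \<gamma> r x (1 / tail_scale \<gamma> x) + Qtail \<gamma> r x (2 / tail_scale \<gamma> x) / 2 ^ Suc r"
    using p by (simp add: numeral_eq_Suc[of "num.One"] atLeast0_atMost_Suc)
  show ?thesis
    unfolding f_def[symmetric] Q s D p main_term_def by simp
qed

section \<open>Transfer to an arbitrary probability space\<close>

text \<open>Independence identifies the joint law on the index set \<open>{1..}\<close> with a
  product measure; reindexing by \<open>Suc\<close> moves it to sequences indexed from 0.\<close>

lemma distr_eq_Sexp:
  fixes M :: "'a measure" and E :: "nat \<Rightarrow> 'a \<Rightarrow> real"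
  assumes "prob_space M"
    and ind: "prob_space.indep_vars M (\<lambda>_. borel) E {1..}"
    and dist: "\<And>i. i \<ge> 1 \<Longrightarrow> distributed M lborel (E i) (exponential_density 1)"
  shows "(\<lambda>\<omega> i. E (Suc i) \<omega>) \<in> measurable M Sexp" and "distr M Sexp (\<lambda>\<omega> i. E (Suc i) \<omega>) = Sexp"
proof -
  interpret prob_space M by fact
  have rv: "E i \<in> borel_measurable M" if "i \<in> {1..}" for i
    using distributed_measurable[OF dist[of i]] that by auto
  have d: "distr M borel (E i) = Exp1" if "i \<in> {1..}" for i
  proof -
    have "distr M borel (E i) = distr M lborel (E i)" by (intro distr_cong) auto
    also have "\<dots> = Exp1" unfolding Exp1_def using dist[of i] that by (intro distributed_distr_eq_density) auto
    finally show ?thesis .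
  qed
  let ?P = "PiM {1..} (\<lambda>_. Exp1)"
  have 1: "distr M (PiM {1..} (\<lambda>_. borel)) (\<lambda>\<omega>. \<lambda>i\<in>{1..}. E i \<omega>) = ?P"
  proof -
    have "distr M (PiM {1..} (\<lambda>_. borel)) (\<lambda>\<omega>. \<lambda>i\<in>{1..}. E i \<omega>) = PiM {1..} (\<lambda>i. distr M borel (E i))"
      using ind rv by (subst (asm) indep_vars_iff_distr_eq_PiM') auto
    also have "\<dots> = ?P" by (intro PiM_cong) (auto simp: d)
    finally show ?thesis .
  qed
  have sP: "sets ?P = sets (PiM {1..} (\<lambda>_. borel))" by (intro sets_PiM_cong) auto
  have mE: "(\<lambda>\<omega>. \<lambda>i\<in>{1..}. E i \<omega>) \<in> measurable M ?P"
    unfolding measurable_cong_sets[OF refl sP] using rv by (intro measurable_restrict) auto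
  have 2: "distr M ?P (\<lambda>\<omega>. \<lambda>i\<in>{1..}. E i \<omega>) = ?P"
    unfolding 1[symmetric] by (intro distr_cong) (auto simp: sP 1)
  have 3: "distr ?P Sexp (\<lambda>\<omega>. \<lambda>n\<in>UNIV. \<omega> (Suc n)) = Sexp"
    unfolding Sexp_def by (rule distr_PiM_reindex) (auto intro: prob_space_Exp1)
  have mS: "(\<lambda>\<omega>. \<lambda>n\<in>UNIV. \<omega> (Suc n)) \<in> measurable ?P Sexp"
    unfolding Sexp_def by (intro measurable_restrict measurable_component_singleton) auto
  have eq: "(\<lambda>\<omega>. \<lambda>n\<in>UNIV. \<omega> (Suc n)) \<circ> (\<lambda>\<omega>. \<lambda>i\<in>{1..}. E i \<omega>) = (\<lambda>\<omega> i. E (Suc i) \<omega>)"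
    by (auto simp: fun_eq_iff)
  show "(\<lambda>\<omega> i. E (Suc i) \<omega>) \<in> measurable M Sexp"
    using measurable_comp[OF mE mS] by (simp only: eq)
  show "distr M Sexp (\<lambda>\<omega> i. E (Suc i) \<omega>) = Sexp"
    using distr_distr[OF mS mE] by (simp only: 2 3 eq)
qed

lemma Yrg_eq_Yf: "Yrg E r \<gamma> \<omega> = Yf \<gamma> r (\<lambda>i. E (Suc i) \<omega>)"
proof -
  have "Zsum E k \<omega> = Zs (\<lambda>i. E (Suc i) \<omega>) k" for k
    unfolding Zsum_def Zs_def by (rule sum.reindex_bij_witness[of _ Suc "\<lambda>i. i - 1"]) auto
  then show ?thesis by (simp add: Yrg_def Yf_def step_fun_def Let_def)
qed

theorem theorem5:
  fixes M :: "'a measure" and E :: "nat \<Rightarrow> 'a \<Rightarrow> real" and \<gamma> :: real and r :: nat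
  assumes "prob_space M"
    and "prob_space.indep_vars M (\<lambda>_. borel) E {1..}"
    and "\<And>i. i \<ge> 1 \<Longrightarrow> distributed M lborel (E i) (exponential_density 1)"
    and "\<gamma> > 0"
  shows "(\<lambda>x. measure M {\<omega> \<in> space M. Yrg E r \<gamma> \<omega> > x}) \<sim>[at_top]
    (\<lambda>x. 2 powr (frac (log 2 (\<gamma> * x)) * real (r + 1)) / (fact (r + 1) * x ^ (r + 1)) *
      (2 powr (- real (r + 1)) + (2 ^ (r + 1) - 1) *
        (\<Sum>l\<in>{0..1::nat}. 2 powr (- (real l * real (r + 1))) *
           measure M {\<omega> \<in> space M. Yrg E 0 \<gamma> \<omega> + Arg_sum r \<gamma> >
              x * (1 - 2 powr (real l - frac (log 2 (\<gamma> * x))))})))"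
proof -
  note X = distr_eq_Sexp[OF assms(1-3)]
  \<comment> \<open>Both probabilities in the claim concern the sequence of variables alone, so only
    its law matters.\<close>
  have transfer: "measure M {\<omega> \<in> space M. P (\<lambda>i. E (Suc i) \<omega>)} = Se.prob {w. P w}"
    if "Measurable.pred Sexp P" for P
  proof -
    have "Se.prob {w. P w} = measure (distr M Sexp (\<lambda>\<omega> i. E (Suc i) \<omega>)) {w. P w}" by (simp only: X(2))
    also have "\<dots> = measure M ((\<lambda>\<omega> i. E (Suc i) \<omega>) -` {w. P w} \<inter> space M)"
      by (rule measure_distr[OF X(1) Collect_in_Sexp[OF that]])
    also have "(\<lambda>\<omega> i. E (Suc i) \<omega>) -` {w. P w} \<inter> space M = {\<omega> \<in> space M. P (\<lambda>i. E (Suc i) \<omega>)}"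
      by auto
    finally show ?thesis by simp
  qed
  have 1: "measure M {\<omega> \<in> space M. Yrg E r \<gamma> \<omega> > x} = Se.prob {w. x < Yf \<gamma> r w}" for x
    unfolding Yrg_eq_Yf by (rule transfer) measurable
  have 2: "measure M {\<omega> \<in> space M. Yrg E 0 \<gamma> \<omega> + Arg_sum r \<gamma> > y} = Se.prob {w. y < Yf \<gamma> 0 w + Arg_sum r \<gamma>}" for y
    unfolding Yrg_eq_Yf by (rule transfer) measurable
  show ?thesis
    unfolding 1 2
  proof (rule asymp_equiv_transfer[OF Yf_tail_asymp_equiv[OF assms(4), of r]])
    show "eventually (\<lambda>x. main_term \<gamma> r x = 2 powr (frac (log 2 (\<gamma> * x)) * real (r + 1)) / (fact (r + 1) * x ^ (r + 1)) *
      (2 powr (- real (r + 1)) + (2 ^ (r + 1) - 1) *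
        (\<Sum>l\<in>{0..1::nat}. 2 powr (- (real l * real (r + 1))) *
           Se.prob {w. Yf \<gamma> 0 w + Arg_sum r \<gamma> > x * (1 - 2 powr (real l - frac (log 2 (\<gamma> * x))))}))) at_top"
      using eventually_gt_at_top[of 0] by eventually_elim (rule main_term_eq)
  qed auto
qed

end
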